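(* Let $n\ge3$, $s\in(0,1)$, $0<\mu<n$, $p\in[1,2^*-1)$, $\lambda\in\mathbb{R}$, $\alpha\in(0,1)$, and let $\Omega\subset\mathbb{R}^n$ be a bounded domain whose boundary $\partial\Omega$ is of class $C^{2,\alpha}$. Let $u\in C^{1,\alpha}(\overline{\Omega})\cap C^2_{\mathrm{loc}}(\Omega)$ be a nontrivial nonnegative solution of problem (P). Then $u>0$ in $\Omega$.
   Context: $2^*=\frac{2n}{n-2}$, $2_\mu^*=\frac{2n-\mu}{n-2}$, and $C(n,s)=\left(\int_{\mathbb{R}^n}\frac{1-\cos z_1}{|z|^{n+2s}}\,dz\right)^{-1}$. Since $\Omega$ is bounded, $\Pi(\Omega)=\{u\in H^1(\mathbb{R}^n): u|_\Omega\in H_0^1(\Omega),\ u\equiv0 \text{ a.e. in }\mathbb{R}^n\setminus\Omega\}$. Problem (P) is $$-\Delta u+(-\Delta)^su=\left(\int_\Omega\frac{|u(y)|^{2_\mu^*}}{|x-y|^\mu}dy\right)|u|^{2_\mu^*-2}u+\lambda u^p\ \text{ in }\Omega,\qquad u\equiv0\ \text{in }\mathbb{R}^n\setminus\Omega,\quad u\ge0\ \text{in }\Omega .$$ A (weak) solution of (P) is a function $u\in\Pi(\Omega)$ with $u\ge0$ a.e. in $\Omega$ such that for all $\varphi\in\Pi(\Omega)$ $$\int_\Omega\nabla u\cdot\nabla\varphi\,dx+\frac{C(n,s)}{2}\int_{\mathbb{R}^n}\int_{\mathbb{R}^n}\frac{(u(x)-u(y))(\varphi(x)-\varphi(y))}{|x-y|^{n+2s}}dx\,dy=\int_\Omega\int_\Omega\frac{|u(y)|^{2_\mu^*}|u(x)|^{2_\mu^*-2}u(x)\varphi(x)}{|x-y|^\mu}dy\,dx+\lambda\int_\Omega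 u^p\varphi\,dx .$$ *)

theory Defs
  imports "HOL-Analysis.Analysis"
begin

section \<open>Classical function spaces\<close>

definition partial :: "'n \<Rightarrow> (real^'n \<Rightarrow> real) \<Rightarrow> real^'n \<Rightarrow> real"
  where "partial i f x = frechet_derivative f (at x) (axis i 1)"

text \<open>\<open>Ck_on k S f\<close> says that \<open>f\<close> is of class C^k on the open set \<open>S\<close>.\<close>

primrec Ck_on :: "nat \<Rightarrow> (real^'n) set \<Rightarrow> (real^'n \<Rightarrow> real) \<Rightarrow> bool" where
  "Ck_on 0 S f \<longleftrightarrow> continuous_on S f"
| "Ck_on (Suc k) S f \<longleftrightarrow> (\<forall>x\<in>S. f differentiable (at x)) \<and> (\<forall>i. Ck_on k S (partial i f))"

definition holder_on :: "real \<Rightarrow> (real^'n) set \<Rightarrow> (real^'n \<Rightarrow> real) \<Rightarrow> bool"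
  where "holder_on \<alpha> S f \<longleftrightarrow> (\<exists>C. \<forall>x\<in>S. \<forall>y\<in>S. \<bar>f x - f y\<bar> \<le> C * dist x y powr \<alpha>)"

text \<open>
  The space of class C^{k,\<open>\<alpha>\<close>} on the closure of an open set \<open>S\<close>. A derivative is only formed inside
  \<open>S\<close>; it is required to extend to a function \<open>g\<close> which is continuous on the closure. The Hoelder
  condition is imposed on the derivatives of top order.
\<close>

primrec Ck_holder_closure :: "nat \<Rightarrow> real \<Rightarrow> (real^'n) set \<Rightarrow> (real^'n \<Rightarrow> real) \<Rightarrow> bool" where
  "Ck_holder_closure 0 \<alpha> S f \<longleftrightarrow> continuous_on (closure S) f \<and> holder_on \<alpha> (closure S) f"
| "Ck_holder_closure (Suc k) \<alpha> S f \<longleftrightarrow>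
     continuous_on (closure S) f \<and> (\<forall>x\<in>S. f differentiable (at x)) \<and>
     (\<forall>i. \<exists>g. (\<forall>x\<in>S. g x = partial i f x) \<and> Ck_holder_closure k \<alpha> S g)"

text \<open>
  The boundary of \<open>\<Omega>\<close> is locally a C^{k,\<open>\<alpha>\<close>} graph over a hyperplane with unit normal \<open>e\<close>, with
  \<open>\<Omega>\<close> on one side of it. The graph function \<open>\<gamma>\<close> of n-1 variables is represented by a function on
  the whole space that is evaluated on that hyperplane only. That \<open>\<gamma>\<close> is globally of class
  C^{k,\<open>\<alpha>\<close>} is no restriction, since it can be multiplied by a cut-off function.
\<close>

definition boundary_Ck_holder :: "nat \<Rightarrow> real \<Rightarrow> (real^'n) set \<Rightarrow> bool"
  where "boundary_Ck_holder k \<alpha> \<Omega> \<longleftrightarrow>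
    (\<forall>x0\<in>frontier \<Omega>. \<exists>r>0. \<exists>e \<gamma>. norm e = 1 \<and> Ck_holder_closure k \<alpha> UNIV \<gamma> \<and>
       \<Omega> \<inter> ball x0 r = {x \<in> ball x0 r. x \<bullet> e > \<gamma> (x - (x \<bullet> e) *\<^sub>R e)})"

section \<open>Sobolev spaces\<close>

definition test_function :: "(real^'n) set \<Rightarrow> (real^'n \<Rightarrow> real) \<Rightarrow> bool"
  where "test_function \<Omega> \<phi> \<longleftrightarrow> (\<forall>k. Ck_on k UNIV \<phi>) \<and>
    compact (closure {x. \<phi> x \<noteq> 0}) \<and> closure {x. \<phi> x \<noteq> 0} \<subseteq> \<Omega>"

definition square_integrable_on :: "('b::euclidean_space \<Rightarrow> 'a::euclidean_space) \<Rightarrow> 'b set \<Rightarrow> bool"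
    (infix "square'_integrable'_on" 50)
  where "f square_integrable_on \<Omega> \<longleftrightarrow> set_borel_measurable lebesgue \<Omega> f \<and>
    set_integrable lebesgue \<Omega> (\<lambda>x. (norm (f x))\<^sup>2)"

definition has_weak_gradient :: "(real^'n) set \<Rightarrow> (real^'n \<Rightarrow> real) \<Rightarrow> (real^'n \<Rightarrow> real^'n) \<Rightarrow> bool"
  where "has_weak_gradient \<Omega> u g \<longleftrightarrow> g square_integrable_on \<Omega> \<and>
    (\<forall>\<phi>. test_function \<Omega> \<phi> \<longrightarrow> (\<forall>i.
       (LINT x:\<Omega>|lebesgue. u x * partial i \<phi> x) = - (LINT x:\<Omega>|lebesgue. (g x $ i) * \<phi> x)))"

text \<open>The functions are not identified up to null sets; all conditions are invariant under
  changes on a null set.\<close>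

definition H1 :: "(real^'n) set \<Rightarrow> (real^'n \<Rightarrow> real) set"
  where "H1 \<Omega> = {u. u square_integrable_on \<Omega> \<and> (\<exists>g. has_weak_gradient \<Omega> u g)}"

text \<open>An arbitrary representative; weak gradients are unique up to null sets.\<close>

definition weak_gradient :: "(real^'n) set \<Rightarrow> (real^'n \<Rightarrow> real) \<Rightarrow> real^'n \<Rightarrow> real^'n"
  where "weak_gradient \<Omega> u = (SOME g. has_weak_gradient \<Omega> u g)"

definition H1_norm :: "(real^'n) set \<Rightarrow> (real^'n \<Rightarrow> real) \<Rightarrow> real"
  where "H1_norm \<Omega> u = sqrt ((LINT x:\<Omega>|lebesgue. (u x)\<^sup>2) +
    (LINT x:\<Omega>|lebesgue. (norm (weak_gradient \<Omega> u x))\<^sup>2))"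

definition H1_0 :: "(real^'n) set \<Rightarrow> (real^'n \<Rightarrow> real) set"
  where "H1_0 \<Omega> = {u \<in> H1 \<Omega>. \<exists>\<phi>. (\<forall>k. test_function \<Omega> (\<phi> k)) \<and>
    (\<lambda>k::nat. H1_norm \<Omega> (\<lambda>x. \<phi> k x - u x)) \<longlonglongrightarrow> 0}"

definition Pi_space :: "(real^'n) set \<Rightarrow> (real^'n \<Rightarrow> real) set"
  where "Pi_space \<Omega> = {u \<in> H1 UNIV. u \<in> H1_0 \<Omega> \<and> (AE x in lebesgue. x \<notin> \<Omega> \<longrightarrow> u x = 0)}"

section \<open>The mixed local-nonlocal Choquard problem\<close>

definition crit_sobolev :: "'n::finite itself \<Rightarrow> real"
  where "crit_sobolev _ = 2 * real CARD('n) / (real CARD('n) - 2)"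

definition crit_choquard :: "'n::finite itself \<Rightarrow> real \<Rightarrow> real"
  where "crit_choquard _ \<mu> = (2 * real CARD('n) - \<mu>) / (real CARD('n) - 2)"

text \<open>The index type \<open>'n\<close> has no distinguished first element. By symmetry the value of the integral
  does not depend on the coordinate that is chosen.\<close>

definition fractional_const :: "'n::finite itself \<Rightarrow> real \<Rightarrow> real"
  where "fractional_const _ s =
    inverse (LINT z|(lebesgue :: (real^'n) measure).
      (1 - cos (z $ (SOME i. True))) / norm z powr (real CARD('n) + 2 * s))"

definition weak_solution ::
    "(real^'n) set \<Rightarrow> real \<Rightarrow> real \<Rightarrow> real \<Rightarrow> real \<Rightarrow> (real^'n \<Rightarrow> real) \<Rightarrow> bool"
  where "weak_solution \<Omega> s \<mu> p lam u \<longleftrightarrow>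
    u \<in> Pi_space \<Omega> \<and> (AE x in lebesgue. x \<in> \<Omega> \<longrightarrow> u x \<ge> 0) \<and>
    (\<forall>\<phi> \<in> Pi_space \<Omega>.
       (LINT x:\<Omega>|lebesgue. weak_gradient \<Omega> u x \<bullet> weak_gradient \<Omega> \<phi> x) +
       fractional_const TYPE('n) s / 2 *
         (LINT y|lebesgue. LINT x|lebesgue.
            (u x - u y) * (\<phi> x - \<phi> y) / norm (x - y) powr (real CARD('n) + 2 * s))
       = (LINT x:\<Omega>|lebesgue. LINT y:\<Omega>|lebesgue.
            \<bar>u y\<bar> powr crit_choquard TYPE('n) \<mu> *
            \<bar>u x\<bar> powr (crit_choquard TYPE('n) \<mu> - 2) * u x * \<phi> x / norm (x - y) powr \<mu>) +
         lam * (LINT x:\<Omega>|lebesgue. u x powr p * \<phi> x))"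

end

theory Submission imports Defs begin

text \<open>
  Suppose that \<open>u\<close> vanishes at a point \<open>x0\<close> of \<open>\<Omega>\<close>. Pointwise, the equation is contradictory at
  \<open>x0\<close>: there \<open>u\<close> has a minimum, so \<open>- \<Delta>u(x0) \<le> 0\<close>; the Choquard term and \<open>\<lambda> u^p\<close> vanish; but
  \<open>(-\<Delta>)^s u(x0)\<close> is a negative multiple of the integral of \<open>u(y) / |x0 - y|^(n+2s)\<close>, which is
  positive as soon as \<open>u\<close> is not zero almost everywhere. It is the nonlocal term that decides, since it sees all
  values of \<open>u\<close> at once.

  The equation is only given in its weak form, so it is tested with a smooth bump \<open>\<phi>\<close> of width
  \<open>\<rho>\<close> at \<open>x0\<close>, and every term is compared with the integral \<open>I\<close> of \<open>\<phi>\<close> as \<open>\<rho> \<rightarrow> 0\<close>.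

  \<^item> Local term: it equals minus the integral of \<open>\<Delta>u \<phi>\<close>
    (\<open>weak_gradient_pairing_test_function\<close>), and \<open>\<Delta>u(x0) \<ge> 0\<close> with \<open>\<Delta>u\<close> continuous, so it is
    at most \<open>o(1) I\<close>.

  \<^item> Nonlocal term: \<open>\<nabla>u\<close> vanishes at \<open>x0\<close> and is differentiable there, so \<open>u\<close> has Lipschitz constant
    \<open>O(\<rho>)\<close> on the ball of radius \<open>2\<rho>\<close>, while \<open>\<phi>\<close> has Lipschitz constant \<open>O(1/\<rho>)\<close>. Interactions inside
    this ball therefore contribute \<open>O(\<rho>^(2-2s)) I\<close>. Interactions with the complement contribute
    another term of this size minus a fixed multiple of \<open>I\<close>, which comes from a ball on which \<open>u\<close> is
    bounded below (\<open>gagliardo_form_upper_bound\<close>, \<open>nonlocal_form_negative_at_zero\<close>). The constant in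
    front of the form is positive because its defining integral converges
    (\<open>fractional_const_pos\<close>).

  \<^item> Right-hand side: the Choquard term is nonnegative and the power term is \<open>o(1) I\<close>.

  For small \<open>\<rho>\<close> the left-hand side is smaller than the right-hand side, a contradiction.

  Two facts about the function spaces support this. Weak gradients are unique up to null sets
  (\<open>weak_gradient_unique\<close>), so the representative chosen for a test function agrees almost
  everywhere with its classical gradient; and test functions belong to the energy space (\<open>test_function_in_Pi_space\<close>).
\<close>

section \<open>Smooth bump functions\<close>

text \<open>
  The powers of \<open>t\<close> in the denominator make the family closed under differentiation up to linear
  combinations, which is how the smoothness of \<open>flat_exp 0\<close> is obtained.
\<close>

definition flat_exp :: "nat \<Rightarrow> real \<Rightarrow> real"
  where "flat_exp k t = (if t > 0 then exp (- (1 / t)) / t ^ k else 0)"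

lemma flat_exp_over_t_tendsto_0: "((\<lambda>t. flat_exp k t / t) \<longlongrightarrow> 0) (at 0)"
proof -
  have "((\<lambda>x::real. x ^ Suc k / exp x) \<longlongrightarrow> 0) at_top"
    by (rule tendsto_power_div_exp_0)
  then have "((\<lambda>t::real. inverse t ^ Suc k / exp (inverse t)) \<longlongrightarrow> 0) (at_right 0)"
    by (rule filterlim_compose[OF _ filterlim_inverse_at_top_right])
  moreover have "\<forall>\<^sub>F t in at_right 0. inverse t ^ Suc k / exp (inverse t) = flat_exp k t / t"
    by (auto simp: eventually_at_right_less flat_exp_def exp_minus field_simps
        intro!: eventually_mono[OF eventually_at_right_less[of 0]])
  ultimately have R: "((\<lambda>t. flat_exp k t / t) \<longlongrightarrow> 0) (at_right 0)"
    by (rule Lim_transform_eventually)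
  have "\<forall>\<^sub>F t in at_left 0. 0 = flat_exp k t / t"
    unfolding eventually_at_left_field by (rule exI[of _ "-1"]) (auto simp: flat_exp_def)
  then have "((\<lambda>t. flat_exp k t / t) \<longlongrightarrow> 0) (at_left 0)"
    by (rule Lim_transform_eventually[OF tendsto_const])
  with R show ?thesis
    by (simp add: filterlim_split_at)
qed

lemma flat_exp_deriv:
  "(flat_exp k has_real_derivative flat_exp (k + 2) t + (- real k) * flat_exp (k + 1) t) (at t)"
proof (cases t "0::real" rule: linorder_cases)
  case less
  have "\<forall>\<^sub>F x in nhds t. x < 0"
    using less by (intro order_tendstoD(2)[OF filterlim_ident]) auto
  then have "\<forall>\<^sub>F x in nhds t. flat_exp k x = 0"
    by eventually_elim (auto simp: flat_exp_def)
  then have "(flat_exp k has_real_derivative 0) (at t) \<longleftrightarrow> ((\<lambda>_. 0) has_real_derivative 0) (at t)"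
    by (intro DERIV_cong_ev) auto
  with less show ?thesis by (simp add: flat_exp_def)
next
  case equal
  show ?thesis
    using flat_exp_over_t_tendsto_0[of k] equal
    by (simp add: has_field_derivative_iff flat_exp_def)
next
  case greater
  have "\<forall>\<^sub>F x in nhds t. x > 0"
    using greater by (intro order_tendstoD(1)[OF filterlim_ident]) auto
  then have "\<forall>\<^sub>F x in nhds t. flat_exp k x = exp (- (1 / x)) / x ^ k"
    by eventually_elim (auto simp: flat_exp_def)
  then have eq: "(flat_exp k has_real_derivative D) (at t) \<longleftrightarrow>
      ((\<lambda>x. exp (- (1 / x)) / x ^ k) has_real_derivative D) (at t)" for D
    by (intro DERIV_cong_ev) auto
  have pw: "((\<lambda>x. x ^ k) has_real_derivative real k * t ^ k / t) (at t)"
    using DERIV_pow[of k t] greater by (cases k) auto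
  have ex: "((\<lambda>x. exp (- (1 / x))) has_real_derivative exp (- (1 / t)) / t\<^sup>2) (at t)"
    using greater by (auto intro!: derivative_eq_intros simp: power2_eq_square)
  show ?thesis unfolding eq
    by (rule DERIV_cong[OF DERIV_divide[OF ex pw]])
       (use greater in \<open>simp_all add: flat_exp_def field_simps power2_eq_square\<close>)
qed

text \<open>
  A class of functions that is visibly closed under differentiation, so that no derivative of higher
  order has to be computed. It contains the products of shifted and reflected copies of
  \<open>flat_exp 0\<close>.
\<close>

inductive smooth1 :: "(real \<Rightarrow> real) \<Rightarrow> bool" where
  flat: "smooth1 (flat_exp k)"
| const: "smooth1 (\<lambda>_. c)"
| add: "smooth1 f \<Longrightarrow> smooth1 g \<Longrightarrow> smooth1 (\<lambda>t. f t + g t)"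
| mult: "smooth1 f \<Longrightarrow> smooth1 g \<Longrightarrow> smooth1 (\<lambda>t. f t * g t)"
| affine: "smooth1 f \<Longrightarrow> smooth1 (\<lambda>t. f (a * t + b))"

lemma smooth1_deriv: "smooth1 f \<Longrightarrow> \<exists>f'. smooth1 f' \<and> (\<forall>t. (f has_real_derivative f' t) (at t))"
proof (induction rule: smooth1.induct)
  case (flat k)
  have "smooth1 (\<lambda>t. flat_exp (k + 2) t + (- real k) * flat_exp (k + 1) t)"
    by (intro smooth1.intros)
  then show ?case using flat_exp_deriv by blast
next
  case (const c)
  show ?case by (rule exI[of _ "\<lambda>_. 0"]) (auto intro: smooth1.intros)
next
  case (add f g)
  then obtain f' g' where "smooth1 f'" "smooth1 g'"
    "\<forall>t. (f has_real_derivative f' t) (at t)" "\<forall>t. (g has_real_derivative g' t) (at t)" by blast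
  then show ?case
    by (intro exI[of _ "\<lambda>t. f' t + g' t"]) (auto intro: smooth1.intros derivative_intros)
next
  case (mult f g)
  then obtain f' g' where "smooth1 f'" "smooth1 g'"
    "\<forall>t. (f has_real_derivative f' t) (at t)" "\<forall>t. (g has_real_derivative g' t) (at t)" by blast
  with mult.hyps show ?case
    by (intro exI[of _ "\<lambda>t. f' t * g t + f t * g' t"])
       (auto intro!: smooth1.intros derivative_eq_intros)
next
  case (affine f a b)
  then obtain f' where f': "smooth1 f'" "\<And>t. (f has_real_derivative f' t) (at t)" by blast
  have "((\<lambda>t. f (a * t + b)) has_real_derivative f' (a * t + b) * a) (at t)" for t
    by (rule DERIV_chain2[OF f'(2)]) (auto intro!: derivative_eq_intros)
  with f'(1) show ?case
    by (intro exI[of _ "\<lambda>t. f' (a * t + b) * a"]) (auto intro: smooth1.intros)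
qed

lemma has_derivative_prod_coords:
  fixes f f' :: "'n::finite \<Rightarrow> real \<Rightarrow> real"
  assumes "\<And>i t. (f i has_real_derivative f' i t) (at t)"
  shows "((\<lambda>x::real^'n. \<Prod>i\<in>UNIV. f i (x $ i)) has_derivative
     (\<lambda>h. \<Sum>i\<in>UNIV. (f' i (x $ i) * h $ i) * (\<Prod>j\<in>UNIV - {i}. f j (x $ j)))) (at x)"
proof (rule has_derivative_prod)
  fix i :: 'n
  have "((\<lambda>x::real^'n. x $ i) has_derivative (\<lambda>h. h $ i)) (at x)"
    by (rule bounded_linear.has_derivative[OF bounded_linear_vec_nth has_derivative_ident])
  from has_derivative_compose[OF this, of "f i" "\<lambda>t. f' i (x $ i) * t"] assms[of i "x $ i"]
  show "((\<lambda>x::real^'n. f i (x $ i)) has_derivative (\<lambda>h. f' i (x $ i) * h $ i)) (at x)"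
    by (simp add: has_field_derivative_def)
qed

lemma partial_prod_coords:
  fixes f f' :: "'n::finite \<Rightarrow> real \<Rightarrow> real"
  assumes "\<And>i t. (f i has_real_derivative f' i t) (at t)"
  shows "partial j (\<lambda>x::real^'n. \<Prod>i\<in>UNIV. f i (x $ i)) =
    (\<lambda>x. \<Prod>i\<in>UNIV. (f(j := f' j)) i (x $ i))"
proof
  fix x :: "real^'n"
  have "frechet_derivative (\<lambda>x::real^'n. \<Prod>i\<in>UNIV. f i (x $ i)) (at x) =
     (\<lambda>h. \<Sum>i\<in>UNIV. (f' i (x $ i) * h $ i) * (\<Prod>j\<in>UNIV - {i}. f j (x $ j)))"
    by (rule frechet_derivative_at[symmetric, OF has_derivative_prod_coords[OF assms]])
  then have "partial j (\<lambda>x::real^'n. \<Prod>i\<in>UNIV. f i (x $ i)) x =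
     (\<Sum>i\<in>UNIV. if j = i then f' i (x $ i) * (\<Prod>j\<in>UNIV - {i}. f j (x $ j)) else 0)"
    unfolding partial_def by (simp only:) (rule sum.cong, auto simp: axis_def)
  also have "\<dots> = f' j (x $ j) * (\<Prod>i\<in>UNIV - {j}. f i (x $ i))"
    by simp
  also have "\<dots> = f' j (x $ j) * (\<Prod>i\<in>UNIV - {j}. (f(j := f' j)) i (x $ i))"
    by (auto intro!: prod.cong)
  also have "\<dots> = (\<Prod>i\<in>UNIV. (f(j := f' j)) i (x $ i))"
    by (subst prod.remove[of UNIV j]) auto
  finally show "partial j (\<lambda>x::real^'n. \<Prod>i\<in>UNIV. f i (x $ i)) x = \<dots>" .
qed

text \<open>
  Differentiating a product of functions of one coordinate each replaces one factor by its
  derivative, hence leads to a product of the same form; the induction on the order of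
  differentiability therefore quantifies over all such products.
\<close>

lemma Ck_on_prod_coords:
  fixes f :: "'n::finite \<Rightarrow> real \<Rightarrow> real"
  assumes "\<And>i. smooth1 (f i)"
  shows "Ck_on k UNIV (\<lambda>x::real^'n. \<Prod>i\<in>UNIV. f i (x $ i))"
  using assms
proof (induction k arbitrary: f)
  case (0 f)
  have "isCont (f i) t" for i t
    using smooth1_deriv[OF 0[of i]] DERIV_isCont by blast
  then have "continuous_on UNIV (f i)" for i
    by (simp add: continuous_on_eq_continuous_at)
  then have "continuous_on UNIV (\<lambda>x::real^'n. f i (x $ i))" for i
    by (rule continuous_on_compose2) (auto intro: continuous_intros)
  then show ?case
    by (auto intro!: continuous_on_prod)
next
  case (Suc k f)
  obtain f' where f': "\<And>i. smooth1 (f' i)" "\<And>i t. (f i has_real_derivative f' i t) (at t)"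
    using smooth1_deriv[OF Suc.prems] by metis
  show ?case
    unfolding Ck_on.simps partial_prod_coords[of f f', OF f'(2)]
    using has_derivative_prod_coords[of f f', OF f'(2)] Suc.prems f'(1)
    by (intro conjI ballI allI Suc.IH) (auto simp: differentiable_def)
qed

text \<open>
  A bump on the box with corners \<open>a\<close> and \<open>b\<close>. The parameter \<open>\<kappa>\<close> controls how steep it is: for
  \<open>\<kappa> \<rightarrow> \<infinity>\<close> the bump tends to the indicator function of the open box, while \<open>\<kappa>\<close> of the order of the
  inverse side length gives the rescaled copies of one fixed profile.
\<close>

definition box_bump :: "real \<Rightarrow> real^'n \<Rightarrow> real^'n \<Rightarrow> real^'n \<Rightarrow> real"
  where "box_bump \<kappa> a b x =
    (\<Prod>i\<in>UNIV. flat_exp 0 (\<kappa> * (x $ i - a $ i)) * flat_exp 0 (\<kappa> * (b $ i - x $ i)))"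

lemma flat_exp_0_bounds: "0 \<le> flat_exp 0 t" "flat_exp 0 t \<le> 1"
  by (auto simp: flat_exp_def)

lemma box_bump_bounds: "0 \<le> box_bump \<kappa> a b x" "box_bump \<kappa> a b x \<le> 1"
  by (auto simp: box_bump_def intro!: prod_nonneg prod_le_1 mult_nonneg_nonneg mult_le_one
      flat_exp_0_bounds)

lemma box_bump_eq_0:
  assumes "\<kappa> \<ge> 0" "x \<notin> box a b"
  shows "box_bump \<kappa> a b x = 0"
proof -
  obtain i where "\<not> (a $ i < x $ i \<and> x $ i < b $ i)"
    using assms(2) by (auto simp: mem_box_cart)
  then have "\<kappa> * (x $ i - a $ i) \<le> 0 \<or> \<kappa> * (b $ i - x $ i) \<le> 0"
    using assms(1) by (auto simp: mult_le_0_iff)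
  then have "flat_exp 0 (\<kappa> * (x $ i - a $ i)) * flat_exp 0 (\<kappa> * (b $ i - x $ i)) = 0"
    by (auto simp: flat_exp_def)
  then show ?thesis
    unfolding box_bump_def by (intro prod_zero) auto
qed

lemma test_function_box_bump:
  fixes a b :: "real^'n"
  assumes "\<kappa> \<ge> 0" "cbox a b \<subseteq> \<Omega>"
  shows "test_function \<Omega> (box_bump \<kappa> a b)"
proof -
  have "smooth1 (\<lambda>t. flat_exp 0 (\<kappa> * t + (- \<kappa> * a $ i)) * flat_exp 0 ((-\<kappa>) * t + \<kappa> * b $ i))" for i
    by (intro smooth1.intros)
  then have "Ck_on k UNIV (\<lambda>x::real^'n. \<Prod>i\<in>UNIV.
      flat_exp 0 (\<kappa> * (x $ i) + (- \<kappa> * a $ i)) * flat_exp 0 ((-\<kappa>) * (x $ i) + \<kappa> * b $ i))" for k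
    by (rule Ck_on_prod_coords[of "\<lambda>i t. flat_exp 0 (\<kappa> * t + (- \<kappa> * a $ i)) * flat_exp 0 ((-\<kappa>) * t + \<kappa> * b $ i)"])
  also have "(\<lambda>x::real^'n. \<Prod>i\<in>UNIV.
      flat_exp 0 (\<kappa> * (x $ i) + (- \<kappa> * a $ i)) * flat_exp 0 ((-\<kappa>) * (x $ i) + \<kappa> * b $ i))
      = box_bump \<kappa> a b"
    by (auto simp: fun_eq_iff box_bump_def algebra_simps)
  finally have 1: "Ck_on k UNIV (box_bump \<kappa> a b)" for k .
  have "{x. box_bump \<kappa> a b x \<noteq> 0} \<subseteq> cbox a b"
    using box_bump_eq_0[OF assms(1), of _ a b] box_subset_cbox[of a b] by blast
  then have 2: "closure {x. box_bump \<kappa> a b x \<noteq> 0} \<subseteq> cbox a b"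
    by (rule closure_minimal) (rule closed_cbox)
  then have "compact (closure {x. box_bump \<kappa> a b x \<noteq> 0})"
    using compact_Int_closed[of "cbox a b" "closure {x. box_bump \<kappa> a b x \<noteq> 0}"]
    by (simp add: Int_absorb1)
  with 1 2 assms(2) show ?thesis
    by (auto simp: test_function_def)
qed

lemma flat_exp_0_lipschitz: "\<bar>flat_exp 0 s - flat_exp 0 t\<bar> \<le> 2 * \<bar>s - t\<bar>"
proof -
  \<comment> \<open>With \<open>x = 1 / t\<close> the derivative is \<open>x\<^sup>2 exp (- x)\<close>, and \<open>exp x \<ge> x\<^sup>2 / 2\<close>.\<close>
  have bd: "\<bar>flat_exp 2 t\<bar> \<le> 2" for t
  proof (cases "t > 0")
    case True
    define x where "x = 1 / t"
    have "x > 0" using True by (simp add: x_def)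
    then have "x\<^sup>2 / 2 \<le> exp x" using exp_lower_Taylor_quadratic[of x] by simp
    then show ?thesis using True
      by (simp add: flat_exp_def exp_minus x_def field_simps)
  qed (simp add: flat_exp_def)
  have "\<And>t. (flat_exp 0 has_real_derivative flat_exp 2 t) (at t within UNIV)"
    using flat_exp_deriv[of 0] by (simp add: numeral_2_eq_2)
  from field_differentiable_bound[OF convex_UNIV this, of "2"] bd
  show ?thesis by (simp add: real_norm_def)
qed

lemma box_bump_lipschitz:
  fixes a b x y :: "real^'n"
  assumes "\<kappa> \<ge> 0"
  shows "\<bar>box_bump \<kappa> a b x - box_bump \<kappa> a b y\<bar> \<le> 4 * real CARD('n) * \<kappa> * dist x y"
proof -
  let ?f = "\<lambda>x i. flat_exp 0 (\<kappa> * (x $ i - a $ i))" and ?g = "\<lambda>x i. flat_exp 0 (\<kappa> * (b $ i - x $ i))"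
  have "\<bar>box_bump \<kappa> a b x - box_bump \<kappa> a b y\<bar> \<le> (\<Sum>i\<in>UNIV. norm (?f x i * ?g x i - ?f y i * ?g y i))"
    unfolding box_bump_def real_norm_def[symmetric]
    by (rule norm_prod_diff) (auto intro!: mult_le_one flat_exp_0_bounds simp: abs_mult flat_exp_0_bounds)
  also have "\<dots> \<le> (\<Sum>i\<in>(UNIV::'n set). 4 * \<kappa> * dist x y)"
  proof (rule sum_mono)
    fix i :: 'n
    have *: "\<bar>x $ i - y $ i\<bar> \<le> dist x y"
      using component_le_norm_cart[of "x - y" i] by (simp add: dist_norm)
    have "?f x i * ?g x i - ?f y i * ?g y i = (?f x i - ?f y i) * ?g x i + ?f y i * (?g x i - ?g y i)"
      by (simp add: algebra_simps)
    also have "norm \<dots> \<le> \<bar>?f x i - ?f y i\<bar> * 1 + 1 * \<bar>?g x i - ?g y i\<bar>"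
      unfolding real_norm_def
      by (rule order_trans[OF abs_triangle_ineq])
         (auto simp: abs_mult flat_exp_0_bounds intro!: add_mono mult_left_le mult_left_le_one_le)
    also have "\<dots> \<le> 2 * \<bar>\<kappa> * (x $ i - a $ i) - \<kappa> * (y $ i - a $ i)\<bar>
         + 2 * \<bar>\<kappa> * (b $ i - x $ i) - \<kappa> * (b $ i - y $ i)\<bar>"
      using flat_exp_0_lipschitz by (simp add: add_mono)
    also have "\<dots> = 4 * \<kappa> * \<bar>x $ i - y $ i\<bar>"
      using assms by (simp add: right_diff_distrib[symmetric] abs_mult abs_minus_commute)
    also have "\<dots> \<le> 4 * \<kappa> * dist x y"
      using * assms by (intro mult_left_mono) auto
    finally show "norm (?f x i * ?g x i - ?f y i * ?g y i) \<le> 4 * \<kappa> * dist x y" .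
  qed
  finally show ?thesis by (simp add: algebra_simps)
qed

section \<open>Integration by parts against test functions\<close>

lemma partial_has_real_derivative:
  assumes "f differentiable (at (x + t *\<^sub>R axis i 1))"
  shows "((\<lambda>t. f (x + t *\<^sub>R axis i 1)) has_real_derivative partial i f (x + t *\<^sub>R axis i 1)) (at t)"
proof -
  let ?D = "frechet_derivative f (at (x + t *\<^sub>R axis i 1))"
  have D: "(f has_derivative ?D) (at (x + t *\<^sub>R axis i 1))"
    using assms frechet_derivative_works by blast
  have "((\<lambda>t. x + t *\<^sub>R axis i 1) has_derivative (\<lambda>h. h *\<^sub>R axis i 1)) (at t)"
    by (auto intro!: derivative_eq_intros)
  from has_derivative_compose[OF this D]
  have "((\<lambda>t. f (x + t *\<^sub>R axis i 1)) has_derivative (\<lambda>h. ?D (h *\<^sub>R axis i 1))) (at t)" .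
  moreover have "?D (h *\<^sub>R axis i 1) = partial i f (x + t *\<^sub>R axis i 1) * h" for h
    using linear_scale[OF has_derivative_linear[OF D]] by (simp add: partial_def)
  ultimately show ?thesis
    by (simp add: has_field_derivative_def)
qed

lemma partial_unique:
  assumes "(f has_derivative D) (at x)"
  shows "partial i f x = D (axis i 1)"
  using frechet_derivative_at[OF assms] by (simp add: partial_def)

lemma partial_eq_0_off_support:
  assumes "closed K" "\<And>x. x \<notin> K \<Longrightarrow> f x = 0" "x \<notin> K"
  shows "(f has_derivative (\<lambda>_. 0)) (at x)" and "partial i f x = 0"
proof -
  have "((\<lambda>_. 0) has_derivative (\<lambda>_. 0)) (at x)" by simp
  then show *: "(f has_derivative (\<lambda>_. 0)) (at x)"
    by (rule has_derivative_transform_within_open[of _ _ _ _ "- K"]) (use assms in auto)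
  show "partial i f x = 0"
    using partial_unique[OF *] by simp
qed

lemma compact_support_integrable_bounded:
  fixes g :: "real^'n \<Rightarrow> real"
  assumes "continuous_on UNIV g" "compact K" "\<And>x. x \<notin> K \<Longrightarrow> g x = 0"
  shows "integrable lborel g" and "\<exists>B\<ge>0. \<forall>x. \<bar>g x\<bar> \<le> B"
proof -
  have c: "continuous_on K g" using assms(1) continuous_on_subset by blast
  have "(\<lambda>x. indicator K x *\<^sub>R g x) = g"
    using assms(3) by (auto simp: fun_eq_iff indicator_def)
  with borel_integrable_compact[OF assms(2) c] show "integrable lborel g" by simp
  obtain B where "\<forall>x\<in>K. norm (g x) \<le> B"
    using compact_imp_bounded[OF compact_continuous_image[OF c assms(2)]]
    by (auto simp: bounded_iff)
  then show "\<exists>B\<ge>0. \<forall>x. \<bar>g x\<bar> \<le> B"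
    using assms(3) by (intro exI[of _ "max B 0"]) (metis abs_zero max.cobounded2 max.coboundedI1 real_norm_def)
qed

lemma lborel_translation:
  fixes f :: "'a::euclidean_space \<Rightarrow> real"
  assumes f: "integrable lborel f"
  shows "integrable lborel (\<lambda>x. f (x + c))" and "(LINT x|lborel. f (x + c)) = (LINT x|lborel. f x)"
proof -
  have [measurable]: "f \<in> borel_measurable borel"
    using borel_measurable_integrable[OF f] by simp
  have "integrable (distr lborel borel ((+) c)) f"
    by (simp add: lborel_distr_plus f)
  then show "integrable lborel (\<lambda>x. f (x + c))"
    by (subst (asm) integrable_distr_eq) (auto simp: add.commute)
  have "(LINT x|lborel. f x) = (LINT x|distr lborel borel ((+) c). f x)"
    by (simp add: lborel_distr_plus)
  also have "\<dots> = (LINT x|lborel. f (x + c))"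
    by (subst integral_distr) (auto simp: add.commute)
  finally show "(LINT x|lborel. f (x + c)) = (LINT x|lborel. f x)" ..
qed

text \<open>
  Lebesgue measure is translation invariant, so all difference quotients of \<open>f\<close> in a coordinate
  direction integrate to zero. They converge to the partial derivative and are dominated by a
  multiple of the indicator function of a ball. No iterated integration is involved.
\<close>

lemma integral_partial_eq_0:
  fixes f :: "real^'n \<Rightarrow> real"
  assumes diff: "\<And>x. f differentiable (at x)" and cont: "continuous_on UNIV (partial i f)"
    and K: "compact K" "\<And>x. x \<notin> K \<Longrightarrow> f x = 0"
  shows "(LINT x|lborel. partial i f x) = 0"
proof -
  let ?e = "axis i 1 :: real^'n"
  define h where "h k = inverse (real (Suc k))" for k
  have h: "h k > 0" "h k \<le> 1" for k by (auto simp: h_def inverse_le_1_iff)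
  have p0: "\<And>x. x \<notin> K \<Longrightarrow> partial i f x = 0"
    using partial_eq_0_off_support(2)[where f = f, OF compact_imp_closed[OF K(1)] K(2)] by blast
  have cf: "continuous_on UNIV f"
    using diff by (simp add: continuous_at_imp_continuous_on differentiable_imp_continuous_within)
  have mf[measurable]: "f \<in> borel_measurable borel"
    by (rule borel_measurable_continuous_onI[OF cf])
  have mp[measurable]: "partial i f \<in> borel_measurable borel"
    by (rule borel_measurable_continuous_onI[OF cont])
  have fi: "integrable lborel f"
    by (rule compact_support_integrable_bounded(1)[OF cf K])
  have fi': "integrable lborel (\<lambda>x. f (x + c))" for c
    by (rule lborel_translation(1)[OF fi])
  obtain B where B: "B \<ge> 0" "\<And>x. \<bar>partial i f x\<bar> \<le> B"
    using compact_support_integrable_bounded(2)[OF cont K(1) p0] by blast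
  obtain R where "\<forall>x\<in>K. norm x \<le> R"
    using compact_imp_bounded[OF K(1)] unfolding bounded_iff by blast
  then have R: "K \<subseteq> cball 0 R" by auto
  define d where "d k x = (f (x + h k *\<^sub>R ?e) - f x) / h k" for k x
  have "(LINT x|lborel. d k x) = 0" for k
  proof -
    have "(LINT x|lborel. d k x) = ((LINT x|lborel. f (x + h k *\<^sub>R ?e)) - (LINT x|lborel. f x)) / h k"
      unfolding d_def using fi fi' by simp
    then show ?thesis by (simp add: lborel_translation(2)[OF fi])
  qed
  moreover have "(\<lambda>k. LINT x|lborel. d k x) \<longlonglongrightarrow> (LINT x|lborel. partial i f x)"
  proof (rule integral_dominated_convergence[where w = "\<lambda>x. indicator (cball 0 (R + 1)) x * B"])
    show "AE x in lborel. (\<lambda>k. d k x) \<longlonglongrightarrow> partial i f x"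
    proof (rule AE_I2)
      fix x
      have "((\<lambda>t. f (x + t *\<^sub>R ?e)) has_real_derivative partial i f x) (at 0)"
        using partial_has_real_derivative[of f x 0 i] diff by simp
      then have "((\<lambda>t. (f (x + t *\<^sub>R ?e) - f x) / t) \<longlongrightarrow> partial i f x) (at 0)"
        by (simp add: has_field_derivative_iff)
      moreover have "filterlim h (at 0) sequentially"
        using LIMSEQ_inverse_real_of_nat h(1) unfolding filterlim_at h_def
        by (auto simp: less_le)
      ultimately show "(\<lambda>k. d k x) \<longlonglongrightarrow> partial i f x"
        unfolding d_def by (rule filterlim_compose)
    qed
    show "AE x in lborel. norm (d k x) \<le> indicator (cball 0 (R + 1)) x * B" for k
    proof (rule AE_I2)
      fix x
      show "norm (d k x) \<le> indicator (cball 0 (R + 1)) x * B"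
      proof (cases "x \<in> cball 0 (R + 1)")
        case True
        have "norm (f (x + h k *\<^sub>R ?e) - f (x + 0 *\<^sub>R ?e)) \<le> B * norm (h k - 0)"
          by (rule field_differentiable_bound[of UNIV "\<lambda>t. f (x + t *\<^sub>R ?e)"
                "\<lambda>t. partial i f (x + t *\<^sub>R ?e)" B])
             (auto intro!: partial_has_real_derivative diff B)
        then show ?thesis using True h(1)[of k] by (simp add: d_def field_simps)
      next
        case False
        have "norm (h k *\<^sub>R ?e) \<le> 1"
          using h[of k] by simp
        then have "norm x \<le> norm (x + h k *\<^sub>R ?e) + 1"
          using norm_triangle_ineq4[of "x + h k *\<^sub>R ?e" "h k *\<^sub>R ?e"] by simp
        with False R have "x \<notin> K" "x + h k *\<^sub>R ?e \<notin> K" by auto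
        then show ?thesis using K(2) False by (simp add: d_def)
      qed
    qed
    have "compact (cball 0 (R + 1) :: (real^'n) set)" by simp
    from borel_integrable_compact[OF this, of "\<lambda>_. B"]
    show "integrable lborel (\<lambda>x::real^'n. indicator (cball 0 (R + 1)) x * B)" by simp
  qed (auto simp: d_def[abs_def])
  ultimately show ?thesis
    by (simp add: LIMSEQ_const_iff)
qed

lemma test_functionD:
  assumes "test_function \<Omega> \<phi>"
  obtains K where "compact K" "K \<subseteq> \<Omega>" "\<And>x. x \<notin> K \<Longrightarrow> \<phi> x = 0" "\<And>i x. x \<notin> K \<Longrightarrow> partial i \<phi> x = 0"
proof -
  let ?K = "closure {x. \<phi> x \<noteq> 0}"
  have 0: "\<phi> x = 0" if "x \<notin> ?K" for x
    using closure_subset[of "{x. \<phi> x \<noteq> 0}"] that by blast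
  have "partial i \<phi> x = 0" if "x \<notin> ?K" for x i
    by (rule partial_eq_0_off_support(2)[where f = \<phi>, OF closed_closure 0 that])
  note partial_0 = this
  have "compact ?K" "?K \<subseteq> \<Omega>" using assms unfolding test_function_def by blast+
  then show ?thesis using 0 partial_0 by (rule that)
qed

lemma compact_closure_subset:
  fixes K :: "'a::t2_space set"
  assumes "compact K" "closure S \<subseteq> K"
  shows "compact (closure S)"
  using compact_Int_closed[OF assms(1) closed_closure[of S]] assms(2) by (simp add: Int_absorb1)

lemma test_function_partial:
  assumes "test_function \<Omega> \<phi>"
  shows "test_function \<Omega> (partial i \<phi>)"
proof -
  obtain K where K: "compact K" "K \<subseteq> \<Omega>" "\<And>i x. x \<notin> K \<Longrightarrow> partial i \<phi> x = 0"
    using test_functionD[OF assms] by metis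
  have "Ck_on k UNIV (partial i \<phi>)" for k
    using assms by (auto simp: test_function_def dest: spec[of _ "Suc k"])
  moreover have "closure {x. partial i \<phi> x \<noteq> 0} \<subseteq> K"
    using K by (intro closure_minimal) (auto simp: compact_imp_closed)
  ultimately show ?thesis
    using K(2) compact_closure_subset[OF K(1)] unfolding test_function_def by blast
qed

lemma test_function_mono: "test_function \<Omega> \<phi> \<Longrightarrow> \<Omega> \<subseteq> \<Omega>' \<Longrightarrow> test_function \<Omega>' \<phi>"
  by (auto simp: test_function_def)

lemma test_function_differentiable:
  assumes "test_function \<Omega> \<phi>"
  shows "\<phi> differentiable (at x)"
  using assms by (auto simp: test_function_def dest: spec[of _ 1])

lemma test_function_continuous:
  assumes "test_function \<Omega> \<phi>"
  shows "continuous_on S \<phi>"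
  using assms unfolding test_function_def
  by (metis Ck_on.simps(1) continuous_on_subset subset_UNIV)

text \<open>
  The open sets \<open>\<Omega>\<close> and \<open>- K\<close> cover the space, and the function is continuous on both, being zero on
  the latter.
\<close>

lemma cutoff_continuous:
  assumes "open \<Omega>" "continuous_on \<Omega> g" "closed K" "K \<subseteq> \<Omega>" "\<And>x. x \<notin> K \<Longrightarrow> g x = (0::real)"
  shows "continuous_on UNIV (\<lambda>x. if x \<in> \<Omega> then g x else 0)"
proof -
  have "continuous_on (\<Omega> \<union> - K) (\<lambda>x. if x \<in> \<Omega> then g x else 0)"
  proof (rule continuous_on_open_Un)
    show "continuous_on \<Omega> (\<lambda>x. if x \<in> \<Omega> then g x else 0)"
      using assms(2) by (simp cong: continuous_on_cong)
    have "continuous_on (- K) (\<lambda>_. 0::real)" by simp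
    then show "continuous_on (- K) (\<lambda>x. if x \<in> \<Omega> then g x else 0)"
      by (rule continuous_on_eq) (use assms in auto)
  qed (use assms in auto)
  moreover have "\<Omega> \<union> - K = UNIV" using assms(4) by blast
  ultimately show ?thesis by simp
qed

lemma cutoff_set_integral:
  fixes g :: "real^'n \<Rightarrow> real"
  assumes "open \<Omega>" "continuous_on \<Omega> g" "compact K" "K \<subseteq> \<Omega>" "\<And>x. x \<notin> K \<Longrightarrow> g x = 0"
  shows "set_integrable lebesgue \<Omega> g"
    and "(LINT x:\<Omega>|lebesgue. g x) = (LINT x|lborel. (if x \<in> \<Omega> then g x else 0))"
proof -
  let ?g = "\<lambda>x. if x \<in> \<Omega> then g x else 0"
  have eq: "(\<lambda>x. indicator \<Omega> x *\<^sub>R g x) = ?g" by (auto simp: fun_eq_iff)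
  have c: "continuous_on UNIV ?g"
    by (rule cutoff_continuous) (use assms compact_imp_closed in auto)
  have i: "integrable lborel ?g"
    using assms by (intro compact_support_integrable_bounded(1)[OF c assms(3)]) auto
  then have m: "?g \<in> borel_measurable lborel" by auto
  show "set_integrable lebesgue \<Omega> g"
    unfolding set_integrable_def eq using i by (simp add: integrable_completion[OF m])
  show "(LINT x:\<Omega>|lebesgue. g x) = (LINT x|lborel. ?g x)"
    unfolding set_lebesgue_integral_def eq by (rule integral_completion[OF m])
qed

text \<open>
  The product of \<open>w\<close> and \<open>\<phi>\<close>, extended by zero, has compact support in \<open>\<Omega>\<close>, so the integral of its
  partial derivative vanishes.
\<close>

lemma integration_by_parts_test_function:
  fixes w :: "real^'n \<Rightarrow> real"
  assumes "open \<Omega>" and w: "Ck_on 1 \<Omega> w" and \<phi>: "test_function \<Omega> \<phi>"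
  shows "(LINT x:\<Omega>|lebesgue. w x * partial i \<phi> x) = - (LINT x:\<Omega>|lebesgue. partial i w x * \<phi> x)"
proof -
  obtain K where K: "compact K" "K \<subseteq> \<Omega>" "\<And>x. x \<notin> K \<Longrightarrow> \<phi> x = 0" "\<And>i x. x \<notin> K \<Longrightarrow> partial i \<phi> x = 0"
    using test_functionD[OF \<phi>] by metis
  have w': "\<And>x. x \<in> \<Omega> \<Longrightarrow> w differentiable (at x)" "continuous_on \<Omega> (partial i w)"
    using w by auto
  have cw: "continuous_on \<Omega> w"
    using w'(1) by (simp add: continuous_at_imp_continuous_on differentiable_imp_continuous_within)
  note c\<phi> = test_function_continuous[OF \<phi>] test_function_continuous[OF test_function_partial[OF \<phi>]]
  define f where "f x = (if x \<in> \<Omega> then w x * \<phi> x else 0)" for x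
  have f0: "x \<notin> K \<Longrightarrow> f x = 0" for x using K by (auto simp: f_def)
  have inside: "f differentiable (at x) \<and> partial i f x = w x * partial i \<phi> x + partial i w x * \<phi> x"
    if "x \<in> \<Omega>" for x
  proof -
    have "((\<lambda>x. w x * \<phi> x) has_derivative (\<lambda>h. w x * frechet_derivative \<phi> (at x) h
        + frechet_derivative w (at x) h * \<phi> x)) (at x)"
      using w'(1)[OF that] test_function_differentiable[OF \<phi>]
      by (intro has_derivative_mult) (auto simp: frechet_derivative_works)
    then have D: "(f has_derivative (\<lambda>h. w x * frechet_derivative \<phi> (at x) h
        + frechet_derivative w (at x) h * \<phi> x)) (at x)"
      by (rule has_derivative_transform_within_open[OF _ assms(1) that]) (auto simp: f_def)
    show ?thesis
      using partial_unique[OF D] D by (auto simp: partial_def differentiable_def)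
  qed
  have outside: "f differentiable (at x)" "partial i f x = 0" if "x \<notin> K" for x
    using partial_eq_0_off_support[where f = f, OF compact_imp_closed[OF K(1)] f0 that]
    by (auto simp: differentiable_def)
  let ?g = "\<lambda>x. w x * partial i \<phi> x + partial i w x * \<phi> x"
  have eq: "partial i f = (\<lambda>x. if x \<in> \<Omega> then ?g x else 0)"
    using inside outside K by (auto simp: fun_eq_iff)
  have cg: "continuous_on \<Omega> ?g"
    by (intro continuous_intros cw w'(2) c\<phi>)
  have "(LINT x|lborel. partial i f x) = 0"
  proof (rule integral_partial_eq_0[OF _ _ K(1) f0])
    show "f differentiable (at x)" for x using inside outside K by blast
    show "continuous_on UNIV (partial i f)" unfolding eq
      by (rule cutoff_continuous[OF assms(1) cg compact_imp_closed[OF K(1)] K(2)]) (use K in auto)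
  qed
  also have "(LINT x|lborel. partial i f x) = (LINT x:\<Omega>|lebesgue. ?g x)"
    unfolding eq by (rule cutoff_set_integral(2)[OF assms(1) cg K(1,2), symmetric]) (use K in auto)
  also have "\<dots> = (LINT x:\<Omega>|lebesgue. w x * partial i \<phi> x) + (LINT x:\<Omega>|lebesgue. partial i w x * \<phi> x)"
    by (intro set_integral_add cutoff_set_integral(1)[OF assms(1) _ K(1,2)] continuous_intros cw w'(2) c\<phi>)
       (use K in auto)
  finally show ?thesis by simp
qed

section \<open>Uniqueness of weak gradients\<close>

text \<open>
  The positive and the negative part of \<open>h\<close> are the densities of two measures that agree on all
  boxes, hence everywhere, because boxes form an intersection-stable generator of the Borel sets.
\<close>

lemma AE_zero_of_box_integrals:
  fixes h :: "'a::euclidean_space \<Rightarrow> real"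
  assumes h: "integrable lborel h" and 0: "\<And>a b. (LINT x|lborel. indicator (box a b) x * h x) = 0"
  shows "AE x in lborel. h x = 0"
proof -
  have [measurable]: "h \<in> borel_measurable borel"
    using borel_measurable_integrable[OF h] by simp
  let ?M = "density lborel (\<lambda>x. ennreal (h x))" and ?N = "density lborel (\<lambda>x. ennreal (- h x))"
  let ?E = "range (\<lambda>(a, b). box a b) :: 'a set set"
  have fin: "(\<integral>\<^sup>+x. ennreal (h x) \<partial>lborel) \<noteq> \<infinity>" "(\<integral>\<^sup>+x. ennreal (- h x) \<partial>lborel) \<noteq> \<infinity>"
    using h by (auto simp: real_integrable_def)
  have box: "emeasure ?M (box a b) = (\<integral>\<^sup>+x. ennreal (indicator (box a b) x * h x) \<partial>lborel)"
    "emeasure ?N (box a b) = (\<integral>\<^sup>+x. ennreal (- (indicator (box a b) x * h x)) \<partial>lborel)" for a b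
    by (subst emeasure_density; force intro!: nn_integral_cong simp: indicator_def)+
  have eq: "emeasure ?M (box a b) = emeasure ?N (box a b)"
    and finM: "emeasure ?M (box a b) \<noteq> \<infinity>" for a b
  proof -
    have i: "integrable lborel (\<lambda>x. indicator (box a b) x * h x)"
      using integrable_mult_indicator[of "box a b" lborel h] h by simp
    then have f: "emeasure ?M (box a b) \<noteq> \<infinity>" "emeasure ?N (box a b) \<noteq> \<infinity>"
      unfolding box by (auto simp: real_integrable_def)
    then show "emeasure ?M (box a b) \<noteq> \<infinity>" by simp
    have "enn2real (emeasure ?M (box a b)) - enn2real (emeasure ?N (box a b)) = 0"
      unfolding box real_lebesgue_integral_def[OF i, symmetric] by (rule 0)
    with f show "emeasure ?M (box a b) = emeasure ?N (box a b)"
      by (metis eq_iff_diff_eq_0 ennreal_enn2real infinity_ennreal_def less_top)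
  qed
  have "?M = ?N"
  proof (rule measure_eqI_generator_eq[where E = ?E and \<Omega> = UNIV
        and A = "\<lambda>i. box (- (real i *\<^sub>R One)) (real i *\<^sub>R One)"])
    show "Int_stable ?E" by (auto simp: Int_stable_def box_Int_box)
    show "emeasure ?M X = emeasure ?N X" if "X \<in> ?E" for X
      using that eq by auto
    show "sets ?M = sigma_sets UNIV ?E" "sets ?N = sigma_sets UNIV ?E"
      by (simp_all add: borel_eq_box)
    show "(\<Union>i. box (- (real i *\<^sub>R One)) (real i *\<^sub>R One)) = (UNIV :: 'a set)"
      by (rule UN_box_eq_UNIV)
  qed (use finM in auto)
  then have "AE x in lborel. ennreal (h x) = ennreal (- h x)"
    using fin by (subst (asm) finite_density_unique) auto
  then show ?thesis
    by eventually_elim (metis ennreal_neg ennreal_eq_0_iff linorder_le_cases neg_0_le_iff_le neg_le_0_iff_le order_antisym)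
qed

lemma box_bump_tendsto_indicator:
  fixes a b x :: "real^'n"
  shows "(\<lambda>k. box_bump (real k) a b x) \<longlonglongrightarrow> indicator (box a b) x"
proof (cases "x \<in> box a b")
  case True
  have "(\<lambda>k. flat_exp 0 (real k * t)) \<longlonglongrightarrow> 1" if "t > 0" for t :: real
  proof -
    have "(\<lambda>k. exp (- (inverse (real k) * (1 / t)))) \<longlonglongrightarrow> exp (- (0 * (1 / t)))"
      by (intro tendsto_intros lim_inverse_n)
    moreover have "\<forall>\<^sub>F k in sequentially. exp (- (inverse (real k) * (1 / t))) = flat_exp 0 (real k * t)"
      using eventually_gt_at_top[of 0] by eventually_elim (use that in \<open>auto simp: flat_exp_def field_simps\<close>)
    ultimately show ?thesis by (auto intro: Lim_transform_eventually)
  qed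
  then have "(\<lambda>k. box_bump (real k) a b x) \<longlonglongrightarrow> (\<Prod>i\<in>(UNIV::'n set). 1 * 1)"
    unfolding box_bump_def using True by (intro tendsto_prod tendsto_mult) (auto simp: mem_box_cart)
  with True show ?thesis by simp
qed (simp add: box_bump_eq_0)

lemma square_integrable_mult:
  fixes f g :: "'a::euclidean_space \<Rightarrow> real"
  assumes f: "f square_integrable_on \<Omega>" and g: "g square_integrable_on \<Omega>"
  shows "set_integrable lebesgue \<Omega> (\<lambda>x. f x * g x)"
  unfolding set_integrable_def
proof (rule Bochner_Integration.integrable_bound)
  let ?w = "\<lambda>x. indicator \<Omega> x *\<^sub>R (norm (f x))\<^sup>2 + indicator \<Omega> x *\<^sub>R (norm (g x))\<^sup>2"
  show "integrable lebesgue ?w"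
    using f g by (intro Bochner_Integration.integrable_add) (auto simp: square_integrable_on_def set_integrable_def)
  have "(\<lambda>x. (indicator \<Omega> x *\<^sub>R f x) * (indicator \<Omega> x *\<^sub>R g x)) \<in> borel_measurable lebesgue"
    using f g by (intro borel_measurable_times) (auto simp: square_integrable_on_def set_borel_measurable_def)
  also have "(\<lambda>x. (indicator \<Omega> x *\<^sub>R f x) * (indicator \<Omega> x *\<^sub>R g x)) = (\<lambda>x. indicator \<Omega> x *\<^sub>R (f x * g x))"
    by (auto simp: indicator_def fun_eq_iff)
  finally show "\<dots> \<in> borel_measurable lebesgue" .
  have "\<bar>a * b\<bar> \<le> a\<^sup>2 + b\<^sup>2" for a b :: real
  proof -
    have "2 * \<bar>a\<bar> * \<bar>b\<bar> \<le> a\<^sup>2 + b\<^sup>2"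
      using sum_squares_bound[of "\<bar>a\<bar>" "\<bar>b\<bar>"] by simp
    moreover have "0 \<le> \<bar>a\<bar> * \<bar>b\<bar>" by simp
    ultimately show ?thesis unfolding abs_mult by linarith
  qed
  then show "AE x in lebesgue. norm (indicator \<Omega> x *\<^sub>R (f x * g x)) \<le> norm (?w x)"
    by (auto intro!: AE_I2 simp: indicator_def)
qed

text \<open>
  The fundamental lemma of the calculus of variations. Steep bumps on a box inside \<open>\<Omega>\<close> converge to
  its indicator function, so \<open>g\<close> integrates to zero over all such boxes. On a fixed box this forces
  \<open>g\<close> to vanish almost everywhere, and countably many boxes cover \<open>\<Omega>\<close>.
\<close>

lemma vanishes_if_orthogonal_to_test_functions:
  fixes g :: "real^'n \<Rightarrow> real"
  assumes "open \<Omega>" and g: "g square_integrable_on \<Omega>"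
    and orth: "\<And>\<phi>. test_function \<Omega> \<phi> \<Longrightarrow> (LINT x:\<Omega>|lebesgue. g x * \<phi> x) = 0"
  shows "AE x in lebesgue. x \<in> \<Omega> \<longrightarrow> g x = 0"
proof -
  define G where "G x = indicator \<Omega> x * g x" for x
  have G: "G \<in> borel_measurable lebesgue" "integrable lebesgue (\<lambda>x. (G x)\<^sup>2)"
  proof -
    show "G \<in> borel_measurable lebesgue"
      using g by (simp add: G_def[abs_def] square_integrable_on_def set_borel_measurable_def)
    have "(\<lambda>x. (G x)\<^sup>2) = (\<lambda>x. indicator \<Omega> x *\<^sub>R (norm (g x))\<^sup>2)"
      by (auto simp: G_def fun_eq_iff indicator_def)
    then show "integrable lebesgue (\<lambda>x. (G x)\<^sup>2)"
      using g by (simp add: square_integrable_on_def set_integrable_def)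
  qed
  \<comment> \<open>A Borel representative, so that integrals can be taken with respect to \<open>lborel\<close>.\<close>
  obtain G' where m[measurable]: "G' \<in> borel_measurable lborel" and ae: "AE x in lborel. G x = G' x"
    using completion_ex_borel_measurable_real[OF G(1)] by blast
  have ae': "AE x in lebesgue. G x = G' x" using ae by (rule AE_completion)
  have m': "G' \<in> borel_measurable lebesgue" by (rule measurable_completion[OF m])
  have "integrable lebesgue (\<lambda>x. (G' x)\<^sup>2)"
    by (rule integrable_cong_AE_imp[OF G(2)]) (use m' ae' in auto)
  then have sq: "integrable lborel (\<lambda>x. (G' x)\<^sup>2)"
    by (subst (asm) integrable_completion) auto
  have dom: "integrable lborel (\<lambda>x. indicator (box a b) x + (G' x)\<^sup>2)" for a b :: "real^'n"
    using sq integrable_real_indicator[of "box a b" lborel] by (intro Bochner_Integration.integrable_add) (auto simp: emeasure_lborel_box_eq)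
  have le: "\<bar>t\<bar> \<le> 1 + t\<^sup>2" for t :: real
  proof (cases "\<bar>t\<bar> \<le> 1")
    case True then show ?thesis by (simp add: add_increasing2)
  next
    case False
    then have "\<bar>t\<bar> * 1 \<le> \<bar>t\<bar> * \<bar>t\<bar>" by (intro mult_left_mono) auto
    then show ?thesis by (simp add: power2_eq_square)
  qed
  have bump0: "(LINT x|lborel. box_bump k a b x * G' x) = 0" if "cbox a b \<subseteq> \<Omega>" "k \<ge> 0" for a b :: "real^'n" and k
  proof -
    let ?\<phi> = "box_bump k a b"
    have t: "test_function \<Omega> ?\<phi>" by (rule test_function_box_bump) (use that in auto)
    have [measurable]: "?\<phi> \<in> borel_measurable borel"
      by (rule borel_measurable_continuous_onI[OF test_function_continuous[OF t]])
    have m2: "(\<lambda>x. ?\<phi> x * G' x) \<in> borel_measurable lborel" by measurable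
    have "(LINT x|lborel. ?\<phi> x * G' x) = (LINT x|lebesgue. ?\<phi> x * G' x)"
      by (rule integral_completion[OF m2, symmetric])
    also have "\<dots> = (LINT x|lebesgue. ?\<phi> x * G x)"
    proof (rule integral_cong_AE)
      show "(\<lambda>x. ?\<phi> x * G' x) \<in> borel_measurable lebesgue" by (rule measurable_completion[OF m2])
      have "?\<phi> \<in> borel_measurable lebesgue" by (rule measurable_completion) simp
      then show "(\<lambda>x. ?\<phi> x * G x) \<in> borel_measurable lebesgue" using G(1) by simp
    qed (use ae' in auto)
    also have "\<dots> = (LINT x:\<Omega>|lebesgue. g x * ?\<phi> x)"
      by (simp add: set_lebesgue_integral_def G_def mult_ac)
    also have "\<dots> = 0" by (rule orth[OF t])
    finally show ?thesis .
  qed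
  have box0: "(LINT x|lborel. indicator (box a b) x * G' x) = 0" if "cbox a b \<subseteq> \<Omega>" for a b :: "real^'n"
  proof -
    have "(\<lambda>k. LINT x|lborel. box_bump (real k) a b x * G' x) \<longlonglongrightarrow> (LINT x|lborel. indicator (box a b) x * G' x)"
    proof (rule integral_dominated_convergence[OF _ _ dom[of a b]])
      show "AE x in lborel. (\<lambda>k. box_bump (real k) a b x * G' x) \<longlonglongrightarrow> indicator (box a b) x * G' x"
        by (intro AE_I2 tendsto_mult box_bump_tendsto_indicator tendsto_const)
      show "AE x in lborel. norm (box_bump (real k) a b x * G' x) \<le> indicator (box a b) x + (G' x)\<^sup>2" for k
      proof (rule AE_I2)
        fix x
        show "norm (box_bump (real k) a b x * G' x) \<le> indicator (box a b) x + (G' x)\<^sup>2"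
        proof (cases "x \<in> box a b")
          case True
          have "norm (box_bump (real k) a b x * G' x) \<le> 1 * \<bar>G' x\<bar>"
            unfolding norm_mult by (intro mult_mono) (auto simp: abs_of_nonneg box_bump_bounds)
          with le[of "G' x"] True show ?thesis by simp
        qed (simp add: box_bump_eq_0)
      qed
      fix k
      have "test_function \<Omega> (box_bump (real k) a b)" by (rule test_function_box_bump) (use that in auto)
      then have "box_bump (real k) a b \<in> borel_measurable borel"
        by (intro borel_measurable_continuous_onI test_function_continuous)
      then show "(\<lambda>x. box_bump (real k) a b x * G' x) \<in> borel_measurable lborel" by simp
    qed simp
    then show ?thesis by (simp add: bump0[OF that] LIMSEQ_const_iff)
  qed
  have local: "AE x in lborel. x \<in> box c d \<longrightarrow> G' x = 0" if cd: "cbox c d \<subseteq> \<Omega>" for c d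
  proof -
    let ?h = "\<lambda>x. indicator (box c d) x * G' x"
    have "AE x in lborel. ?h x = 0"
    proof (rule AE_zero_of_box_integrals)
      show "integrable lborel ?h"
        by (rule Bochner_Integration.integrable_bound[OF dom[of c d]])
           (auto intro!: AE_I2 order_trans[OF le] simp: indicator_def)
      fix a b :: "real^'n"
      obtain a' b' where ab: "box a b \<inter> box c d = box a' b'"
        by (rule that[OF box_Int_box])
      have "(LINT x|lborel. indicator (box a b) x * ?h x) = (LINT x|lborel. indicator (box a' b') x * G' x)"
        unfolding ab[symmetric] by (intro Bochner_Integration.integral_cong) (auto simp: indicator_def)
      also have "\<dots> = 0"
      proof (cases "box a' b' = {}")
        case False
        have "closure (box a' b') \<subseteq> cbox c d"
          using ab box_subset_cbox[of c d] by (intro closure_minimal) auto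
        then have "cbox a' b' \<subseteq> \<Omega>" using cd by (simp add: closure_box[OF False])
        then show ?thesis by (rule box0)
      qed simp
      finally show "(LINT x|lborel. indicator (box a b) x * ?h x) = 0" .
    qed
    then show ?thesis by eventually_elim (auto simp: indicator_def)
  qed
  define \<F> where "\<F> = {box c d | c d. cbox c d \<subseteq> \<Omega>}"
  obtain \<G> where \<G>: "\<G> \<subseteq> \<F>" "countable \<G>" "\<Union>\<G> = \<Union>\<F>"
    by (rule Lindelof[of \<F>]) (auto simp: \<F>_def open_box)
  have "AE x in lborel. \<forall>B\<in>\<G>. x \<in> B \<longrightarrow> G' x = 0"
    using \<G>(1) local by (subst AE_ball_countable[OF \<G>(2)]) (auto simp: \<F>_def)
  moreover have "\<Omega> \<subseteq> \<Union>\<G>"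
  proof
    fix x assume "x \<in> \<Omega>"
    then obtain c d where "cbox c d \<subseteq> \<Omega>" "x \<in> box c d"
      using assms(1) open_contains_cbox by metis
    then show "x \<in> \<Union>\<G>" unfolding \<G>(3) by (auto simp: \<F>_def)
  qed
  ultimately have "AE x in lborel. x \<in> \<Omega> \<longrightarrow> G' x = 0"
    by (auto elim!: eventually_mono)
  with ae have "AE x in lborel. x \<in> \<Omega> \<longrightarrow> g x = 0"
    by eventually_elim (auto simp: G_def)
  then show ?thesis by (rule AE_completion)
qed

lemma continuous_compact_support_square_integrable:
  fixes f :: "real^'n \<Rightarrow> 'b::euclidean_space"
  assumes "open \<Omega>" "continuous_on UNIV f" "compact K" "\<And>x. x \<notin> K \<Longrightarrow> f x = 0"
  shows "f square_integrable_on \<Omega>"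
proof -
  have O: "\<Omega> \<in> sets lebesgue" using assms(1) by auto
  have c: "continuous_on UNIV (\<lambda>x. (norm (f x))\<^sup>2)" using assms(2) by (intro continuous_intros)
  have "integrable lborel (\<lambda>x. (norm (f x))\<^sup>2)"
    by (rule compact_support_integrable_bounded(1)[OF c assms(3)]) (use assms(4) in simp)
  then have "integrable lebesgue (\<lambda>x. (norm (f x))\<^sup>2)"
    by (subst integrable_completion) (auto intro: borel_measurable_continuous_onI c)
  then have "set_integrable lebesgue \<Omega> (\<lambda>x. (norm (f x))\<^sup>2)"
    unfolding set_integrable_def by (rule integrable_mult_indicator[OF O])
  moreover have "f \<in> borel_measurable lebesgue"
    by (rule measurable_completion) (use assms(2) in \<open>auto intro: borel_measurable_continuous_onI\<close>)
  then have "set_borel_measurable lebesgue \<Omega> f"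
    unfolding set_borel_measurable_def
    by (intro borel_measurable_scaleR borel_measurable_indicator O)
  ultimately show ?thesis by (simp add: square_integrable_on_def)
qed

lemma test_function_square_integrable:
  assumes "open \<Omega>" "test_function S \<phi>"
  shows "\<phi> square_integrable_on \<Omega>"
  using test_functionD[OF assms(2)] test_function_continuous[OF assms(2)]
    continuous_compact_support_square_integrable[OF assms(1)] by metis

lemma square_integrable_component:
  fixes g :: "real^'n \<Rightarrow> real^'n"
  assumes "g square_integrable_on \<Omega>"
  shows "(\<lambda>x. g x $ i) square_integrable_on \<Omega>"
proof -
  have m: "(\<lambda>x. indicator \<Omega> x *\<^sub>R g x) \<in> borel_measurable lebesgue"
    and s: "integrable lebesgue (\<lambda>x. indicator \<Omega> x *\<^sub>R (norm (g x))\<^sup>2)"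
    using assms by (auto simp: square_integrable_on_def set_borel_measurable_def set_integrable_def)
  have "(\<lambda>x. (indicator \<Omega> x *\<^sub>R g x) \<bullet> axis i 1) \<in> borel_measurable lebesgue"
    by (rule borel_measurable_inner[OF m borel_measurable_const])
  then have mi: "(\<lambda>x. indicator \<Omega> x *\<^sub>R (g x $ i)) \<in> borel_measurable lebesgue"
    by (simp add: inner_axis)
  have "integrable lebesgue (\<lambda>x. indicator \<Omega> x *\<^sub>R (norm (g x $ i))\<^sup>2)"
  proof (rule Bochner_Integration.integrable_bound[OF s])
    have "(\<lambda>x. (indicator \<Omega> x *\<^sub>R (g x $ i))\<^sup>2) \<in> borel_measurable lebesgue"
      using mi by simp
    also have "(\<lambda>x. (indicator \<Omega> x *\<^sub>R (g x $ i))\<^sup>2) = (\<lambda>x. indicator \<Omega> x *\<^sub>R (norm (g x $ i))\<^sup>2)"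
      by (auto simp: fun_eq_iff indicator_def)
    finally show "\<dots> \<in> borel_measurable lebesgue" .
    show "AE x in lebesgue. norm (indicator \<Omega> x *\<^sub>R (norm (g x $ i))\<^sup>2) \<le> norm (indicator \<Omega> x *\<^sub>R (norm (g x))\<^sup>2)"
      using component_le_norm_cart[of "g _" i]
      by (auto intro!: AE_I2 simp: indicator_def abs_le_square_iff[symmetric] simp del: power2_abs)
  qed
  with mi show ?thesis
    by (simp add: square_integrable_on_def set_borel_measurable_def set_integrable_def)
qed

lemma square_integrable_diff:
  fixes f g :: "'a::euclidean_space \<Rightarrow> real"
  assumes f: "f square_integrable_on \<Omega>" and g: "g square_integrable_on \<Omega>"
  shows "(\<lambda>x. f x - g x) square_integrable_on \<Omega>"
proof -
  have 1: "(\<lambda>x. indicator \<Omega> x *\<^sub>R (f x - g x)) \<in> borel_measurable lebesgue"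
    unfolding scaleR_diff_right using f g
    by (intro borel_measurable_diff) (simp_all only: square_integrable_on_def set_borel_measurable_def)
  have "set_integrable lebesgue \<Omega> (\<lambda>x. f x * f x + g x * g x - 2 * (f x * g x))"
    by (intro set_integral_diff set_integral_add set_integrable_mult_right square_integrable_mult f g)
  also have "(\<lambda>x. f x * f x + g x * g x - 2 * (f x * g x)) = (\<lambda>x. (norm (f x - g x))\<^sup>2)"
    by (auto simp: fun_eq_iff power2_eq_square algebra_simps)
  finally show ?thesis
    using 1 by (simp add: square_integrable_on_def set_borel_measurable_def)
qed

lemma weak_gradient_unique:
  fixes g g' :: "real^'n \<Rightarrow> real^'n"
  assumes "open \<Omega>" and g: "has_weak_gradient \<Omega> u g" and g': "has_weak_gradient \<Omega> u g'"
  shows "AE x in lebesgue. x \<in> \<Omega> \<longrightarrow> g x = g' x"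
proof -
  have sq: "(\<lambda>x. g x $ i) square_integrable_on \<Omega>" "(\<lambda>x. g' x $ i) square_integrable_on \<Omega>" for i
    using g g' by (auto simp: has_weak_gradient_def intro: square_integrable_component)
  have "AE x in lebesgue. x \<in> \<Omega> \<longrightarrow> g x $ i - g' x $ i = 0" for i
  proof (rule vanishes_if_orthogonal_to_test_functions[OF assms(1)])
    show "(\<lambda>x. g x $ i - g' x $ i) square_integrable_on \<Omega>"
      by (intro square_integrable_diff sq)
    fix \<phi> :: "real^'n \<Rightarrow> real" assume \<phi>: "test_function \<Omega> \<phi>"
    note s = test_function_square_integrable[OF assms(1) \<phi>]
    have "(LINT x:\<Omega>|lebesgue. (g x $ i - g' x $ i) * \<phi> x) =
        (LINT x:\<Omega>|lebesgue. (g x $ i) * \<phi> x) - (LINT x:\<Omega>|lebesgue. (g' x $ i) * \<phi> x)"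
      unfolding left_diff_distrib by (intro set_integral_diff square_integrable_mult sq s)
    also have "\<dots> = 0"
    proof -
      have "(LINT x:\<Omega>|lebesgue. u x * partial i \<phi> x) = - (LINT x:\<Omega>|lebesgue. (g x $ i) * \<phi> x)"
        "(LINT x:\<Omega>|lebesgue. u x * partial i \<phi> x) = - (LINT x:\<Omega>|lebesgue. (g' x $ i) * \<phi> x)"
        using g g' \<phi> unfolding has_weak_gradient_def by blast+
      then show ?thesis by simp
    qed
    finally show "(LINT x:\<Omega>|lebesgue. (g x $ i - g' x $ i) * \<phi> x) = 0" .
  qed
  then have "AE x in lebesgue. \<forall>i\<in>UNIV. x \<in> \<Omega> \<longrightarrow> g x $ i - g' x $ i = 0"
    by (subst AE_finite_all) auto
  then show ?thesis by eventually_elim (auto simp: vec_eq_iff)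
qed

section \<open>Test functions in the energy space\<close>

lemma has_weak_gradient_test_function:
  fixes \<phi> :: "real^'n \<Rightarrow> real"
  assumes "open \<Omega>" "test_function \<Omega> \<phi>"
  shows "has_weak_gradient \<Omega> \<phi> (\<lambda>x. \<chi> i. partial i \<phi> x)"
  unfolding has_weak_gradient_def
proof (intro conjI allI impI)
  obtain K where K: "compact K" "\<And>i x. x \<notin> K \<Longrightarrow> partial i \<phi> x = 0"
    using test_functionD[OF assms(2)] by metis
  show "(\<lambda>x. \<chi> i. partial i \<phi> x) square_integrable_on \<Omega>"
  proof (rule continuous_compact_support_square_integrable[OF assms(1) _ K(1)])
    show "continuous_on UNIV (\<lambda>x. \<chi> i. partial i \<phi> x)"
      by (intro continuous_on_vec_lambda test_function_continuous[OF test_function_partial[OF assms(2)]])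
  qed (simp add: K(2) vec_eq_iff)
  fix \<psi> :: "real^'n \<Rightarrow> real" and i assume \<psi>: "test_function \<Omega> \<psi>"
  have "Ck_on 1 \<Omega> \<phi>"
    using test_function_differentiable[OF assms(2)] test_function_continuous[OF test_function_partial[OF assms(2)]]
    by simp
  from integration_by_parts_test_function[OF assms(1) this \<psi>]
  show "(LINT x:\<Omega>|lebesgue. \<phi> x * partial i \<psi> x) = - (LINT x:\<Omega>|lebesgue. ((\<chi> i. partial i \<phi> x) $ i) * \<psi> x)"
    by simp
qed

lemma has_weak_gradient_weak_gradient:
  "u \<in> H1 \<Omega> \<Longrightarrow> has_weak_gradient \<Omega> u (weak_gradient \<Omega> u)"
  unfolding weak_gradient_def H1_def using someI_ex[of "has_weak_gradient \<Omega> u"] by blast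

lemma test_function_in_H1: "open \<Omega> \<Longrightarrow> test_function \<Omega> \<phi> \<Longrightarrow> \<phi> \<in> H1 \<Omega>"
  unfolding H1_def using has_weak_gradient_test_function test_function_square_integrable by blast

text \<open>
  The norm is defined through a chosen weak gradient; even for the zero function it takes the
  uniqueness theorem to see that the choice vanishes almost everywhere.
\<close>

lemma H1_norm_zero:
  fixes \<Omega> :: "(real^'n) set"
  assumes "open \<Omega>"
  shows "H1_norm \<Omega> (\<lambda>x. 0) = 0"
proof -
  have z: "has_weak_gradient \<Omega> (\<lambda>x. 0) (\<lambda>x. 0)"
    unfolding has_weak_gradient_def
    by (simp add: square_integrable_on_def set_borel_measurable_def set_integrable_def set_lebesgue_integral_def)
  then have "has_weak_gradient \<Omega> (\<lambda>x. 0) (weak_gradient \<Omega> (\<lambda>x. 0))"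
    unfolding weak_gradient_def by (rule someI[where P = "has_weak_gradient \<Omega> (\<lambda>x. 0)"])
  from weak_gradient_unique[OF assms this z]
  have "AE x in lebesgue. x \<in> \<Omega> \<longrightarrow> weak_gradient \<Omega> (\<lambda>x. 0) x = 0" .
  then have "AE x in lebesgue. indicator \<Omega> x *\<^sub>R (norm (weak_gradient \<Omega> (\<lambda>x. 0) x))\<^sup>2 = (0::real)"
    by eventually_elim (auto simp: indicator_def)
  then have "(LINT x:\<Omega>|lebesgue. (norm (weak_gradient \<Omega> (\<lambda>x. 0) x))\<^sup>2) = 0"
    unfolding set_lebesgue_integral_def by (rule integral_eq_zero_AE)
  then show ?thesis by (simp add: H1_norm_def set_lebesgue_integral_def)
qed

text \<open>
  Membership in \<open>H1_0 \<Omega>\<close> is witnessed by the constant sequence, whose difference from \<open>\<phi>\<close> is zero.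
\<close>

lemma test_function_in_Pi_space:
  fixes \<phi> :: "real^'n \<Rightarrow> real"
  assumes "open \<Omega>" "test_function \<Omega> \<phi>"
  shows "\<phi> \<in> Pi_space \<Omega>"
proof -
  have "\<phi> \<in> H1 UNIV"
    by (rule test_function_in_H1[OF open_UNIV test_function_mono[OF assms(2) subset_UNIV]])
  moreover have "\<phi> \<in> H1_0 \<Omega>"
    unfolding H1_0_def using test_function_in_H1[OF assms] assms H1_norm_zero[OF assms(1)]
    by (auto intro!: exI[of _ "\<lambda>_. \<phi>"])
  moreover have "x \<notin> \<Omega> \<longrightarrow> \<phi> x = 0" for x
    using test_functionD[OF assms(2)] by (metis subsetD)
  ultimately show ?thesis by (simp add: Pi_space_def)
qed

text \<open>
  Since \<open>partial i \<phi>\<close> is itself a test function, the definition of the weak gradient of \<open>u\<close> moves the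
  derivative onto it, and two classical integrations by parts move both derivatives back to \<open>u\<close>. In
  this way the weak gradient of \<open>u\<close> need not be identified with the classical one.
\<close>

lemma weak_gradient_pairing_test_function:
  fixes u \<phi> :: "real^'n \<Rightarrow> real"
  assumes \<Omega>: "open \<Omega>" and u: "u \<in> H1 \<Omega>" and C2: "Ck_on 2 \<Omega> u" and \<phi>: "test_function \<Omega> \<phi>"
  shows "(LINT x:\<Omega>|lebesgue. weak_gradient \<Omega> u x \<bullet> weak_gradient \<Omega> \<phi> x) =
    - (LINT x:\<Omega>|lebesgue. (\<Sum>i\<in>UNIV. partial i (partial i u) x) * \<phi> x)"
    and "set_integrable lebesgue \<Omega> (\<lambda>x. (\<Sum>i\<in>UNIV. partial i (partial i u) x) * \<phi> x)"
proof -
  obtain K where K: "compact K" "K \<subseteq> \<Omega>" "\<And>x. x \<notin> K \<Longrightarrow> \<phi> x = 0"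
    using test_functionD[OF \<phi>] by metis
  have C: "Ck_on 1 \<Omega> u" "Ck_on 1 \<Omega> (partial i u)" "continuous_on \<Omega> (partial i (partial i u))" for i
    using C2 by (auto simp: numeral_2_eq_2
        intro!: continuous_at_imp_continuous_on differentiable_imp_continuous_within)
  let ?g = "weak_gradient \<Omega> u" and ?G = "weak_gradient \<Omega> \<phi>"
  have g: "has_weak_gradient \<Omega> u ?g" by (rule has_weak_gradient_weak_gradient[OF u])
  have G: "has_weak_gradient \<Omega> \<phi> ?G"
    by (rule has_weak_gradient_weak_gradient[OF test_function_in_H1[OF \<Omega> \<phi>]])
  have sg: "?g square_integrable_on \<Omega>" and sG: "?G square_integrable_on \<Omega>"
    using g G by (auto simp: has_weak_gradient_def)
  have ae: "AE x in lebesgue. x \<in> \<Omega> \<longrightarrow> ?G x = (\<chi> i. partial i \<phi> x)"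
    by (rule weak_gradient_unique[OF \<Omega> G has_weak_gradient_test_function[OF \<Omega> \<phi>]])
  have int: "set_integrable lebesgue \<Omega> (\<lambda>x. (?g x $ i) * partial i \<phi> x)" for i
    by (intro square_integrable_mult square_integrable_component sg
        test_function_square_integrable[OF \<Omega> test_function_partial[OF \<phi>]])
  have int2: "set_integrable lebesgue \<Omega> (\<lambda>x. partial i (partial i u) x * \<phi> x)" for i
    by (rule cutoff_set_integral(1)[OF \<Omega> _ K(1,2)])
       (use K(3) C(3) test_function_continuous[OF \<phi>] in \<open>auto intro!: continuous_intros\<close>)
  have component: "(LINT x:\<Omega>|lebesgue. (?g x $ i) * partial i \<phi> x) =
      - (LINT x:\<Omega>|lebesgue. partial i (partial i u) x * \<phi> x)" for i
  proof -
    have t: "test_function \<Omega> (partial i \<phi>)" by (rule test_function_partial[OF \<phi>])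
    have "(LINT x:\<Omega>|lebesgue. (?g x $ i) * partial i \<phi> x) = - (LINT x:\<Omega>|lebesgue. u x * partial i (partial i \<phi>) x)"
      using g t unfolding has_weak_gradient_def by fastforce
    also have "\<dots> = (LINT x:\<Omega>|lebesgue. partial i u x * partial i \<phi> x)"
      by (simp add: integration_by_parts_test_function[OF \<Omega> C(1) t])
    also have "\<dots> = - (LINT x:\<Omega>|lebesgue. partial i (partial i u) x * \<phi> x)"
      by (rule integration_by_parts_test_function[OF \<Omega> C(2) \<phi>])
    finally show ?thesis .
  qed
  have sums: "(LINT x:\<Omega>|lebesgue. (\<Sum>i\<in>UNIV. f i x)) = (\<Sum>i\<in>UNIV. LINT x:\<Omega>|lebesgue. f i x)"
    "set_integrable lebesgue \<Omega> (\<lambda>x. \<Sum>i\<in>UNIV. f i x)"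
    if "\<And>i. set_integrable lebesgue \<Omega> (f i)" for f :: "'n \<Rightarrow> real^'n \<Rightarrow> real"
    using that unfolding set_integrable_def set_lebesgue_integral_def scaleR_sum_right
    by (intro Bochner_Integration.integral_sum Bochner_Integration.integrable_sum; blast)+
  have "(LINT x:\<Omega>|lebesgue. ?g x \<bullet> ?G x) = (LINT x:\<Omega>|lebesgue. (\<Sum>i\<in>UNIV. (?g x $ i) * partial i \<phi> x))"
    unfolding set_lebesgue_integral_def
  proof (rule integral_cong_AE)
    have "(\<lambda>x. (indicator \<Omega> x *\<^sub>R ?g x) \<bullet> (indicator \<Omega> x *\<^sub>R ?G x)) \<in> borel_measurable lebesgue"
      using sg sG by (intro borel_measurable_inner) (auto simp: square_integrable_on_def set_borel_measurable_def)
    also have "(\<lambda>x. (indicator \<Omega> x *\<^sub>R ?g x) \<bullet> (indicator \<Omega> x *\<^sub>R ?G x)) = (\<lambda>x. indicator \<Omega> x *\<^sub>R (?g x \<bullet> ?G x))"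
      by (auto simp: fun_eq_iff indicator_def)
    finally show "\<dots> \<in> borel_measurable lebesgue" .
    show "(\<lambda>x. indicator \<Omega> x *\<^sub>R (\<Sum>i\<in>UNIV. ?g x $ i * partial i \<phi> x)) \<in> borel_measurable lebesgue"
      using sums(2)[OF int] unfolding set_integrable_def by (rule borel_measurable_integrable)
    show "AE x in lebesgue. indicator \<Omega> x *\<^sub>R (?g x \<bullet> ?G x) = indicator \<Omega> x *\<^sub>R (\<Sum>i\<in>UNIV. ?g x $ i * partial i \<phi> x)"
      using ae by eventually_elim (auto simp: indicator_def inner_vec_def)
  qed
  also have "\<dots> = (\<Sum>i\<in>UNIV. LINT x:\<Omega>|lebesgue. (?g x $ i) * partial i \<phi> x)"
    by (rule sums(1)[OF int])
  also have "\<dots> = - (\<Sum>i\<in>UNIV. LINT x:\<Omega>|lebesgue. partial i (partial i u) x * \<phi> x)"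
    by (simp add: component sum_negf)
  also have "\<dots> = - (LINT x:\<Omega>|lebesgue. (\<Sum>i\<in>UNIV. partial i (partial i u) x) * \<phi> x)"
    using sums(1)[OF int2] by (simp add: sum_distrib_right)
  finally show "(LINT x:\<Omega>|lebesgue. ?g x \<bullet> ?G x) = \<dots>" .
  show "set_integrable lebesgue \<Omega> (\<lambda>x. (\<Sum>i\<in>UNIV. partial i (partial i u) x) * \<phi> x)"
    using sums(2)[OF int2] by (simp add: sum_distrib_right)
qed

section \<open>Integrability of the kernel\<close>

text \<open>
  A substitute for integration in polar coordinates: \<open>f\<close> is dominated by the sum of the functions
  that are \<open>c k\<close> on the ball of radius \<open>r k\<close> and zero elsewhere, and \<open>S\<close> is the sum of their integrals.
\<close>

lemma dyadic_integrable:
  fixes f :: "'a::euclidean_space \<Rightarrow> real" and r c :: "nat \<Rightarrow> real"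
  assumes f: "f \<in> borel_measurable borel" "\<And>z. 0 \<le> f z"
    and rc: "\<And>k. 0 \<le> r k" "\<And>k. 0 \<le> c k"
    and cover: "\<And>z. f z \<noteq> 0 \<Longrightarrow> \<exists>k. norm z \<le> r k \<and> f z \<le> c k"
    and S: "(\<lambda>k. c k * (unit_ball_vol (real DIM('a)) * r k ^ DIM('a))) sums S"
  shows "integrable lborel f" and "(LINT z|lborel. f z) \<le> S"
proof -
  have [measurable]: "f \<in> borel_measurable borel" by (rule f(1))
  have S0: "0 \<le> S"
    using S rc by (intro sums_le[OF _ sums_zero S]) auto
  have "(\<integral>\<^sup>+(z::'a). ennreal (f z) \<partial>lborel) \<le>
      (\<integral>\<^sup>+(z::'a). (\<Sum>k. ennreal (c k) * indicator (cball 0 (r k)) z) \<partial>lborel)"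
  proof (rule nn_integral_mono)
    fix z :: 'a
    show "ennreal (f z) \<le> (\<Sum>k. ennreal (c k) * indicator (cball 0 (r k)) z)"
    proof (cases "f z = 0")
      case False
      then obtain k where k: "norm z \<le> r k" "f z \<le> c k" using cover by blast
      then have "ennreal (f z) \<le> ennreal (c k) * indicator (cball 0 (r k)) z"
        by (simp add: ennreal_leI)
      also have "\<dots> = (\<Sum>j\<in>{k}. ennreal (c j) * indicator (cball 0 (r j)) z)"
        by (simp only: sum.insert sum.empty finite.emptyI empty_iff not_False_eq_True add_0_right)
      also have "\<dots> \<le> (\<Sum>k. ennreal (c k) * indicator (cball 0 (r k)) z)"
        by (intro sum_le_suminf) auto
      finally show ?thesis .
    qed simp
  qed
  also have "\<dots> = (\<Sum>k. \<integral>\<^sup>+z. ennreal (c k) * indicator (cball (0::'a) (r k)) z \<partial>lborel)"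
    by (rule nn_integral_suminf) (auto intro!: borel_measurable_times_ennreal borel_measurable_indicator)
  also have "\<dots> = (\<Sum>k. ennreal (c k * (unit_ball_vol (real DIM('a)) * r k ^ DIM('a))))"
    using rc by (intro suminf_cong) (simp add: nn_integral_cmult_indicator emeasure_cball ennreal_mult)
  also have "\<dots> = ennreal S"
    using S rc by (subst suminf_ennreal2) (auto simp: sums_iff)
  finally have le: "(\<integral>\<^sup>+z. ennreal (f z) \<partial>lborel) \<le> ennreal S" .
  then show i: "integrable lborel f"
    using f by (intro integrableI_nonneg) (auto simp: top_unique less_top[symmetric])
  have "ennreal (LINT z|lborel. f z) = (\<integral>\<^sup>+z. ennreal (f z) \<partial>lborel)"
    by (rule nn_integral_eq_integral[OF i, symmetric]) (use f in auto)
  with le have "ennreal (LINT z|lborel. f z) \<le> ennreal S" by (simp only:)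
  with S0 show "(LINT z|lborel. f z) \<le> S" by (simp only: ennreal_le_iff)
qed

lemma ex_power_2_between:
  fixes x :: real
  assumes "1 \<le> x"
  shows "\<exists>k. 2 ^ k \<le> x \<and> x \<le> 2 ^ Suc k"
proof -
  define k where "k = nat \<lfloor>log 2 x\<rfloor>"
  have "0 \<le> log 2 x" using assms by simp
  then have k: "real k \<le> log 2 x" "log 2 x \<le> real (Suc k)" unfolding k_def by linarith+
  have "2 powr real k \<le> x" using k(1) assms by (simp add: le_log_iff)
  moreover have "x \<le> 2 powr real (Suc k)" using k(2) assms by (simp add: log_le_iff)
  ultimately show ?thesis by (intro exI[of _ k]) (simp only: powr_realpow zero_less_numeral)
qed

text \<open>
  On the shell \<open>R / 2^(k+1) \<le> |z| \<le> R / 2^k\<close> the function is at most its value at the inner radius, so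
  the sum is geometric with ratio \<open>2^(a-n) < 1\<close>. The constant \<open>A\<close> is uniform in \<open>R\<close>.
\<close>

lemma kernel_near:
  fixes a :: real
  assumes "0 \<le> a" "a < real DIM('a::euclidean_space)"
  shows "\<exists>A\<ge>0. \<forall>R>0. integrable lborel (\<lambda>z::'a. indicator (ball 0 R) z * norm z powr (- a)) \<and>
    (LINT z::'a|lborel. indicator (ball 0 R) z * norm z powr (- a)) \<le> A * R powr (real DIM('a) - a)"
proof -
  define n where "n = DIM('a)"
  define \<omega> where "\<omega> = unit_ball_vol (real n)"
  define q where "q = 2 powr (- (real n - a))"
  have q: "0 < q" "q < 1" using assms by (auto simp: q_def n_def powr_less_one)
  define A where "A = \<omega> * 2 powr a / (1 - q)"
  have "\<omega> \<ge> 0" by (simp add: \<omega>_def)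
  then have "A \<ge> 0" using q by (simp add: A_def)
  have main: "integrable lborel (\<lambda>z::'a. indicator (ball 0 R) z * norm z powr (- a)) \<and>
    (LINT z::'a|lborel. indicator (ball 0 R) z * norm z powr (- a)) \<le> A * R powr (real n - a)"
    if R: "R > 0" for R
  proof -
    define r where "r k = R / 2 ^ k" for k
    define c where "c k = (R / 2 ^ Suc k) powr (- a)" for k
    have cr: "c k * (\<omega> * r k ^ n) = \<omega> * 2 powr a * R powr (real n - a) * q ^ k" for k
    proof -
      have "c k = R powr (- a) * 2 powr a * (2 powr a) ^ k"
        using R by (simp add: c_def powr_divide powr_minus powr_mult powr_power powr_powr
            powr_realpow[symmetric] field_simps)
      moreover have "r k ^ n = R powr real n * (2 powr (- real n)) ^ k"
        using R by (simp add: r_def power_divide powr_realpow powr_minus power_mult[symmetric]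
            mult.commute field_simps)
      moreover have "q = 2 powr a * 2 powr (- real n)"
        by (simp add: q_def powr_add[symmetric])
      moreover have "R powr (real n - a) = R powr (- a) * R powr real n"
        by (simp add: powr_add[symmetric])
      ultimately show ?thesis by (simp add: power_mult_distrib mult_ac)
    qed
    have "(\<lambda>k. q ^ k) sums (1 / (1 - q))" using q by (intro geometric_sums) auto
    then have "(\<lambda>k. \<omega> * 2 powr a * R powr (real n - a) * q ^ k) sums
        (\<omega> * 2 powr a * R powr (real n - a) * (1 / (1 - q)))" by (rule sums_mult)
    then have S: "(\<lambda>k. c k * (unit_ball_vol (real DIM('a)) * r k ^ DIM('a))) sums (A * R powr (real n - a))"
      unfolding cr[symmetric] by (simp add: A_def n_def \<omega>_def mult_ac)
    have cover: "\<exists>k. norm z \<le> r k \<and> indicator (ball 0 R) z * norm z powr (- a) \<le> c k"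
      if "indicator (ball 0 R) z * norm z powr (- a) \<noteq> 0" for z :: 'a
    proof -
      have z: "0 < norm z" "norm z < R" using that by (auto simp: indicator_def split: if_splits)
      then have "1 \<le> R / norm z" by simp
      then obtain k where k: "2 ^ k \<le> R / norm z" "R / norm z \<le> 2 ^ Suc k"
        using ex_power_2_between by blast
      have "norm z powr (- a) \<le> (R / 2 ^ Suc k) powr (- a)"
        using k(2) z R assms by (intro powr_mono2') (auto simp: field_simps)
      moreover have "norm z \<le> r k" using k(1) z by (simp add: r_def field_simps)
      ultimately show ?thesis using z by (auto simp: c_def)
    qed
    have m: "(\<lambda>z::'a. indicator (ball 0 R) z * norm z powr (- a)) \<in> borel_measurable borel"
      by (intro borel_measurable_times borel_measurable_indicator powr_real_measurable) auto
    show ?thesis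
      using dyadic_integrable[OF m _ _ _ cover S] R by (auto simp: r_def c_def)
  qed
  then show ?thesis using \<open>A \<ge> 0\<close> unfolding n_def by blast
qed

text \<open>
  As for the singularity at the origin, now with the shells \<open>R 2^k \<le> |z| \<le> R 2^(k+1)\<close> and the ratio
  \<open>2^(n-b) < 1\<close>.
\<close>

lemma kernel_far:
  fixes b :: real
  assumes "real DIM('a::euclidean_space) < b"
  shows "\<exists>A\<ge>0. \<forall>R>0. integrable lborel (\<lambda>z::'a. indicator (- ball 0 R) z * norm z powr (- b)) \<and>
    (LINT z::'a|lborel. indicator (- ball 0 R) z * norm z powr (- b)) \<le> A * R powr (real DIM('a) - b)"
proof -
  define n where "n = DIM('a)"
  define \<omega> where "\<omega> = unit_ball_vol (real n)"
  define q where "q = 2 powr (real n - b)"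
  have q: "0 < q" "q < 1" using assms by (auto simp: q_def n_def powr_less_one)
  define A where "A = \<omega> * 2 ^ n / (1 - q)"
  have "\<omega> \<ge> 0" by (simp add: \<omega>_def)
  then have "A \<ge> 0" using q by (simp add: A_def)
  have main: "integrable lborel (\<lambda>z::'a. indicator (- ball 0 R) z * norm z powr (- b)) \<and>
    (LINT z::'a|lborel. indicator (- ball 0 R) z * norm z powr (- b)) \<le> A * R powr (real n - b)"
    if R: "R > 0" for R
  proof -
    define r where "r k = R * 2 ^ Suc k" for k
    define c where "c k = (R * 2 ^ k) powr (- b)" for k
    have cr: "c k * (\<omega> * r k ^ n) = \<omega> * 2 ^ n * R powr (real n - b) * q ^ k" for k
    proof -
      have "c k = R powr (- b) * (2 powr (- b)) ^ k"
        using R by (simp add: c_def powr_mult powr_power powr_powr powr_realpow[symmetric] mult.commute)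
      moreover have "r k ^ n = 2 ^ n * R powr real n * (2 powr real n) ^ k"
        using R by (simp add: r_def power_mult_distrib powr_realpow power_mult[symmetric] mult_ac)
      moreover have "q = 2 powr (- b) * 2 powr real n"
        by (simp add: q_def powr_add[symmetric])
      moreover have "R powr (real n - b) = R powr (- b) * R powr real n"
        by (simp add: powr_add[symmetric])
      ultimately show ?thesis by (simp add: power_mult_distrib mult_ac)
    qed
    have "(\<lambda>k. q ^ k) sums (1 / (1 - q))" using q by (intro geometric_sums) auto
    then have "(\<lambda>k. \<omega> * 2 ^ n * R powr (real n - b) * q ^ k) sums
        (\<omega> * 2 ^ n * R powr (real n - b) * (1 / (1 - q)))" by (rule sums_mult)
    then have S: "(\<lambda>k. c k * (unit_ball_vol (real DIM('a)) * r k ^ DIM('a))) sums (A * R powr (real n - b))"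
      unfolding cr[symmetric] by (simp add: A_def n_def \<omega>_def mult_ac)
    have cover: "\<exists>k. norm z \<le> r k \<and> indicator (- ball 0 R) z * norm z powr (- b) \<le> c k"
      if "indicator (- ball 0 R) z * norm z powr (- b) \<noteq> 0" for z :: 'a
    proof -
      have z: "R \<le> norm z" using that by (auto simp: indicator_def split: if_splits)
      then have "1 \<le> norm z / R" using R by simp
      then obtain k where k: "2 ^ k \<le> norm z / R" "norm z / R \<le> 2 ^ Suc k"
        using ex_power_2_between by blast
      have "norm z powr (- b) \<le> (R * 2 ^ k) powr (- b)"
        using k(1) z R assms by (intro powr_mono2') (auto simp: field_simps intro: order_trans[of _ 0])
      moreover have "norm z \<le> r k" using k(2) z R by (simp add: r_def field_simps)
      ultimately show ?thesis using z by (auto simp: c_def)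
    qed
    have m: "(\<lambda>z::'a. indicator (- ball 0 R) z * norm z powr (- b)) \<in> borel_measurable borel"
      by (intro borel_measurable_times borel_measurable_indicator powr_real_measurable) auto
    show ?thesis
      using dyadic_integrable[OF m _ _ _ cover S] R by (auto simp: r_def c_def)
  qed
  then show ?thesis using \<open>A \<ge> 0\<close> unfolding n_def by blast
qed

text \<open>
  If the defining integral diverged, its value would be zero by convention, and the nonlocal term
  would disappear from the equation. It converges since \<open>1 - cos t\<close> is at most \<open>t\<^sup>2\<close>, which tames the
  singularity at the origin as \<open>s < 1\<close>, and at most \<open>2\<close>, which suffices at infinity as \<open>s > 0\<close>.
\<close>

lemma fractional_const_pos:
  assumes "2 \<le> CARD('n::finite)" "0 < s" "s < 1"
  shows "0 < fractional_const TYPE('n) s"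
proof -
  define q where "q = real CARD('n) + 2 * s"
  define j where "j = (SOME i::'n. True)"
  define f where "f z = (1 - cos (z $ j)) / norm z powr q" for z :: "real^'n"
  define w :: "real^'n \<Rightarrow> real" where
    "w z = indicator (ball 0 1) z * norm z powr (- (q - 2)) + 2 * (indicator (- ball 0 1) z * norm z powr (- q))" for z
  have m[measurable]: "f \<in> borel_measurable borel"
    unfolding f_def by (intro borel_measurable_divide powr_real_measurable) (auto intro!: borel_measurable_continuous_onI continuous_intros)
  have f0: "0 \<le> f z" for z by (simp add: f_def)
  have fw: "f z \<le> w z" for z
  proof (cases "z \<in> ball 0 1")
    case False
    have "f z \<le> 2 / norm z powr q"
      unfolding f_def using cos_ge_minus_one[of "z $ j"] by (intro divide_right_mono) auto
    then show ?thesis using False by (simp add: w_def powr_minus divide_inverse)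
  next
    case True
    show ?thesis
    proof (cases "z = 0")
      case False
      have "1 - cos (z $ j) = 2 * (sin (z $ j / 2))\<^sup>2"
        using cos_double_sin[of "z $ j / 2"] by simp
      also have "\<dots> \<le> 2 * (z $ j / 2)\<^sup>2"
        using abs_sin_x_le_abs_x[of "z $ j / 2"] by (simp add: abs_le_square_iff[symmetric])
      also have "\<dots> = (z $ j)\<^sup>2 / 2" by (simp add: power2_eq_square)
      also have "\<dots> \<le> (norm z)\<^sup>2"
      proof -
        have "(z $ j)\<^sup>2 \<le> (norm z)\<^sup>2"
          using component_le_norm_cart[of z j] by (simp add: abs_le_square_iff[symmetric])
        then show ?thesis using zero_le_power2[of "norm z"] by linarith
      qed
      finally have "f z \<le> (norm z)\<^sup>2 / norm z powr q"
        unfolding f_def by (intro divide_right_mono) auto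
      also have "\<dots> = norm z powr (- (q - 2))"
        using False by (simp add: powr_diff powr_minus field_simps)
      finally show ?thesis using True by (simp add: w_def)
    qed (use True in \<open>simp add: f_def w_def\<close>)
  qed
  have near: "integrable lborel (\<lambda>z::real^'n. indicator (ball 0 1) z * norm z powr (- (q - 2)))"
    using kernel_near[where 'a = "real^'n", of "q - 2"] assms by (auto simp: q_def)
  have far: "integrable lborel (\<lambda>z::real^'n. indicator (- ball 0 1) z * norm z powr (- q))"
    using kernel_far[where 'a = "real^'n", of "q"] assms by (auto simp: q_def)
  have w: "integrable lborel w"
    unfolding w_def[abs_def] by (intro Bochner_Integration.integrable_add integrable_mult_right near far)
  have i: "integrable lborel f"
    by (rule Bochner_Integration.integrable_bound[OF w])
       (use f0 fw in \<open>auto intro!: AE_I2 intro: order_trans[OF _ abs_ge_self]\<close>)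
  have "(LINT z|lborel. f z) \<noteq> 0"
  proof
    assume "(LINT z|lborel. f z) = 0"
    then have "AE z in lborel. f z = 0"
      using integral_nonneg_eq_0_iff_AE[OF i] f0 by simp
    moreover have "f z \<noteq> 0" if "z \<in> box 0 1" for z
    proof -
      have z: "0 < z $ j" "z $ j < 1" using that by (auto simp: mem_box_cart)
      then have "cos (z $ j) < cos 0" using pi_gt3 by (intro cos_monotone_0_pi) auto
      moreover have "z \<noteq> 0" using z by auto
      ultimately show ?thesis by (simp add: f_def)
    qed
    ultimately have "AE z in lborel. z \<notin> box 0 (1 :: real^'n)"
      by (auto elim!: eventually_mono)
    then have "AE z in lebesgue. z \<in> - box 0 (1 :: real^'n)"
      by (intro AE_completion) simp
    then have "z \<in> - box 0 (1 :: real^'n)" for z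
      by (intro mem_closed_if_AE_lebesgue) (auto simp: closed_Compl)
    from this[of "vec (1 / 2)"] show False
      by (simp add: mem_box_cart)
  qed
  moreover have "0 \<le> (LINT z|lborel. f z)"
    by (rule Bochner_Integration.integral_nonneg) (use f0 in auto)
  ultimately have "0 < (LINT z|lborel. f z)" by simp
  also have "(LINT z|lborel. f z) = (LINT z|lebesgue. f z)"
    by (rule integral_completion[symmetric]) simp
  finally show ?thesis
    by (simp add: fractional_const_def f_def j_def q_def)
qed

section \<open>The nonlocal quadratic form\<close>

text \<open>
  The kernels to which this is applied are \<open>k x y = h (y - x)\<close> and \<open>k x y = indicator E y\<close>; their
  integral over \<open>y\<close> does not depend on \<open>x\<close>, so Fubini's theorem splits the double integral.
\<close>

lemma pair_integral_weighted_kernel: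
  fixes g :: "'a::euclidean_space \<Rightarrow> real" and k :: "'a \<Rightarrow> 'a \<Rightarrow> real"
  assumes g: "integrable lborel g"
    and km: "(\<lambda>(x, y). k x y) \<in> borel_measurable (lborel \<Otimes>\<^sub>M lborel)"
    and k: "\<And>x. integrable lborel (k x)" "\<And>x y. 0 \<le> k x y" "\<And>x. (LINT y|lborel. k x y) = c"
  shows "integrable (lborel \<Otimes>\<^sub>M lborel) (\<lambda>(x, y). g x * k x y)"
    and "(LINT z|(lborel \<Otimes>\<^sub>M lborel). (case z of (x, y) \<Rightarrow> g x * k x y)) = (LINT x|lborel. g x) * c"
proof -
  have gm[measurable]: "g \<in> borel_measurable lborel" using g by auto
  have [measurable]: "(\<lambda>z. k (fst z) (snd z)) \<in> borel_measurable (lborel \<Otimes>\<^sub>M lborel)"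
    using km by (simp add: case_prod_beta')
  show i: "integrable (lborel \<Otimes>\<^sub>M lborel) (\<lambda>(x, y). g x * k x y)"
  proof (rule lborel_pair.Fubini_integrable)
    show "(\<lambda>(x, y). g x * k x y) \<in> borel_measurable (lborel \<Otimes>\<^sub>M lborel)"
      by (simp add: case_prod_beta')
    have "(\<lambda>x. LINT y|lborel. norm (case (x, y) of (x, y) \<Rightarrow> g x * k x y)) = (\<lambda>x. \<bar>g x\<bar> * c)"
      using k by (simp add: abs_mult fun_eq_iff abs_of_nonneg)
    then show "integrable lborel (\<lambda>x. LINT y|lborel. norm (case (x, y) of (x, y) \<Rightarrow> g x * k x y))"
      using g by simp
    show "AE x in lborel. integrable lborel (\<lambda>y. case (x, y) of (x, y) \<Rightarrow> g x * k x y)"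
      using k(1) by simp
  qed
  show "(LINT z|(lborel \<Otimes>\<^sub>M lborel). (case z of (x, y) \<Rightarrow> g x * k x y)) = (LINT x|lborel. g x) * c"
    using lborel_pair.integral_fst'[OF i] k by simp
qed

text \<open>
  The integrand of the bilinear form of the fractional Laplacian; \<open>q\<close> stands for \<open>n + 2 s\<close>.
\<close>

definition gagliardo :: "real \<Rightarrow> ('a::euclidean_space \<Rightarrow> real) \<Rightarrow> ('a \<Rightarrow> real) \<Rightarrow> 'a \<Rightarrow> 'a \<Rightarrow> real"
  where "gagliardo q v \<phi> x y = (v x - v y) * (\<phi> x - \<phi> y) / norm (x - y) powr q"

text \<open>
  The double integral is split at the ball \<open>D\<close> of radius \<open>2 \<rho>\<close>, twice the radius of the support of
  \<open>\<phi>\<close>. Over \<open>D \<times> D\<close> both factors are controlled by their Lipschitz constants, which lowers the order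
  of the singularity by two. If one point lies outside \<open>D\<close>, then it is at distance at least \<open>\<rho>\<close> from
  the support, so only the tail of the kernel enters: the value of \<open>v\<close> near \<open>x0\<close> contributes at most \<open>V\<close>
  times the mass of this tail, and the values of \<open>v\<close> on \<open>E\<close> enter with a negative sign. By symmetry the
  latter part is counted twice; pairs of points outside \<open>D\<close> do not contribute.
  
  Integrability with respect to the product measure is part of the argument, because an iterated
  integral is zero by convention where an inner integral diverges, and then no bound on the integrand
  would pass to it.
\<close>

lemma gagliardo_form_upper_bound:
  fixes v \<phi> :: "'a::euclidean_space \<Rightarrow> real"
  assumes v: "v \<in> borel_measurable borel" "\<And>x. 0 \<le> v x" "\<And>x. v x \<le> M"
    and \<phi>: "\<phi> \<in> borel_measurable borel" "\<And>x. 0 \<le> \<phi> x" "\<And>x. \<phi> x \<le> 1" "\<And>x. x \<notin> ball x0 \<rho> \<Longrightarrow> \<phi> x = 0"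
    and \<phi>L: "\<And>x y. \<bar>\<phi> x - \<phi> y\<bar> \<le> \<Lambda> * dist x y"
    and vL: "\<And>x y. x \<in> ball x0 (2 * \<rho>) \<Longrightarrow> y \<in> ball x0 (2 * \<rho>) \<Longrightarrow> \<bar>v x - v y\<bar> \<le> \<Gamma> * dist x y"
    and vV: "\<And>x. x \<in> ball x0 \<rho> \<Longrightarrow> v x \<le> V"
    and E: "E \<in> sets borel" "emeasure lborel E < \<infinity>" "E \<inter> ball x0 (2 * \<rho>) = {}"
      "\<And>y. y \<in> E \<Longrightarrow> m \<le> v y" "\<And>x y. x \<in> ball x0 \<rho> \<Longrightarrow> y \<in> E \<Longrightarrow> dist x y \<le> d"
    and pos: "0 < \<rho>" "0 \<le> \<Lambda>" "0 \<le> \<Gamma>" "0 \<le> V" "0 \<le> m" "0 < d" "0 < q"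
    and near: "integrable lborel (\<lambda>z::'a. indicator (ball 0 (4 * \<rho>)) z * norm z powr (2 - q))"
    and far: "integrable lborel (\<lambda>z::'a. indicator (- ball 0 \<rho>) z * norm z powr (- q))"
  shows "(LINT y|lborel. LINT x|lborel. gagliardo q v \<phi> x y) \<le>
     measure lborel (ball x0 (2 * \<rho>)) * (\<Lambda> * \<Gamma>) *
       (LINT z::'a|lborel. indicator (ball 0 (4 * \<rho>)) z * norm z powr (2 - q)) +
     2 * ((LINT x|lborel. \<phi> x) *
       (V * (LINT z::'a|lborel. indicator (- ball 0 \<rho>) z * norm z powr (- q))
         - m * d powr (- q) * measure lborel E))"
proof -
  let ?L = "lborel \<Otimes>\<^sub>M lborel :: ('a \<times> 'a) measure"
  let ?D = "ball x0 (2 * \<rho>)" and ?B = "ball x0 \<rho>"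
  define k1 :: "'a \<Rightarrow> real" where "k1 z = indicator (ball 0 (4 * \<rho>)) z * norm z powr (2 - q)" for z
  define k2 :: "'a \<Rightarrow> real" where "k2 z = indicator (- ball 0 \<rho>) z * norm z powr (- q)" for z
  have [measurable]: "v \<in> borel_measurable borel" "\<phi> \<in> borel_measurable borel" "E \<in> sets borel"
    by fact+
  have K1: "integrable lborel k1" and K2: "integrable lborel k2"
    using near far by (simp_all add: k1_def[abs_def] k2_def[abs_def])
  have [measurable]: "k1 \<in> borel_measurable borel" "k2 \<in> borel_measurable borel"
    using borel_measurable_integrable[OF K1] borel_measurable_integrable[OF K2] by simp_all
  have k0: "0 \<le> k1 z" "0 \<le> k2 z" for z by (simp_all add: k1_def k2_def)
  have B_D: "?B \<subseteq> ?D" using pos by (auto simp: subset_ball)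
  have M0: "0 \<le> M" using v(2,3) order_trans by blast
  have \<phi>i: "integrable lborel \<phi>"
  proof (rule Bochner_Integration.integrable_bound)
    show "integrable lborel (\<lambda>x. indicator ?B x :: real)"
      by (rule integrable_real_indicator) (auto simp: emeasure_ball pos less_imp_le)
    show "AE x in lborel. norm (\<phi> x) \<le> norm (indicator ?B x :: real)"
      using \<phi> by (auto intro!: AE_I2 simp: indicator_def)
  qed simp
  define F where "F x y = gagliardo q v \<phi> x y" for x y
  define N where "N x y = indicator ?D x * indicator ?D y * F x y" for x y
  define H where "H x y = indicator (- ?D) y * (\<phi> x * (v x - v y) / norm (x - y) powr q)" for x y
  have [measurable]: "?D \<in> sets borel" "- ?D \<in> sets borel" by auto
  have mF[measurable]: "(\<lambda>z. F (fst z) (snd z)) \<in> borel_measurable ?L"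
    unfolding F_def gagliardo_def by measurable
  have mN: "(\<lambda>(x, y). N x y) \<in> borel_measurable ?L"
    unfolding N_def case_prod_beta' by measurable
  have mH: "(\<lambda>(x, y). H x y) \<in> borel_measurable ?L"
    unfolding H_def case_prod_beta' by measurable
  have split: "F x y = N x y + H x y + H y x" for x y
  proof -
    have "\<phi> z = 0" if "z \<notin> ?D" for z using that B_D \<phi>(4) by blast
    then show ?thesis
      by (cases "x \<in> ?D"; cases "y \<in> ?D")
         (auto simp: N_def H_def F_def gagliardo_def norm_minus_commute algebra_simps minus_divide_left diff_divide_distrib)
  qed
  have shift: "integrable lborel (\<lambda>y. k (y - x))" "(LINT y|lborel. k (y - x)) = (LINT z|lborel. k z)"
    if "integrable lborel k" for k :: "'a \<Rightarrow> real" and x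
    using lborel_translation[OF that, of "- x"] by simp_all
  have mk: "(\<lambda>(x, y). k1 (y - x)) \<in> borel_measurable ?L" "(\<lambda>(x, y). k2 (y - x)) \<in> borel_measurable ?L"
    by measurable
  have Di: "integrable lborel (\<lambda>x. indicator ?D x :: real)" and Bi: "integrable lborel (\<lambda>x. indicator ?B x :: real)"
    by (rule integrable_real_indicator; simp add: emeasure_ball pos less_imp_le)+
  \<comment> \<open>For both points in \<open>D\<close>, whose distance is below \<open>4 \<rho>\<close>, the increments turn the kernel into \<open>k1\<close>.\<close>
  note W1 = pair_integral_weighted_kernel[OF Di mk(1) shift(1)[OF K1] k0(1) shift(2)[OF K1]]
  have Nle: "\<bar>N x y\<bar> \<le> \<Lambda> * \<Gamma> * (indicator ?D x * k1 (y - x))" for x y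
  proof (cases "x \<in> ?D \<and> y \<in> ?D \<and> x \<noteq> y")
    case True
    define r where "r = norm (x - y)"
    have r: "0 < r" "dist x y = r" "norm (y - x) = r"
      using True by (auto simp: r_def dist_norm norm_minus_commute)
    have "dist x y < 4 * \<rho>"
      using True dist_triangle2[of x y x0] by (auto simp: dist_commute)
    then have k: "k1 (y - x) = r powr (2 - q)" using r by (simp add: k1_def)
    have "\<bar>N x y\<bar> = \<bar>v x - v y\<bar> * \<bar>\<phi> x - \<phi> y\<bar> * r powr (- q)"
      using True by (simp add: N_def F_def gagliardo_def abs_mult r_def powr_minus divide_inverse)
    also have "\<dots> \<le> (\<Gamma> * r) * (\<Lambda> * r) * r powr (- q)"
      using vL[of x y] \<phi>L[of x y] True pos r by (intro mult_right_mono mult_mono) auto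
    also have "\<dots> = \<Lambda> * \<Gamma> * r powr (2 - q)"
      using r by (simp add: powr_diff powr_minus divide_inverse power2_eq_square)
    finally show ?thesis using True k by simp
  next
    case False
    then have "N x y = 0" by (auto simp: N_def F_def gagliardo_def indicator_def)
    then show ?thesis using pos k0 by simp
  qed
  have Ni: "integrable ?L (\<lambda>(x, y). N x y)"
    by (rule Bochner_Integration.integrable_bound[OF integrable_mult_right[OF W1(1), of "\<Lambda> * \<Gamma>"] mN])
       (use Nle in \<open>auto intro!: AE_I2 intro: order_trans[OF _ abs_ge_self]\<close>)
  have Nint: "(LINT z|?L. (case z of (x, y) \<Rightarrow> N x y)) \<le> \<Lambda> * \<Gamma> * (measure lborel ?D * (LINT z|lborel. k1 z))"
  proof -
    have "(LINT z|?L. (case z of (x, y) \<Rightarrow> N x y)) \<le>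
      (LINT z|?L. \<Lambda> * \<Gamma> * (case z of (x, y) \<Rightarrow> indicator ?D x * k1 (y - x)))"
      by (rule integral_mono[OF Ni integrable_mult_right[OF W1(1)]])
         (use Nle in \<open>auto intro: order_trans[OF abs_ge_self]\<close>)
    also have "\<dots> = \<Lambda> * \<Gamma> * (measure lborel ?D * (LINT z|lborel. k1 z))"
      using W1(2) by simp
    finally show ?thesis .
  qed
  \<comment> \<open>With one point in the support of \<open>\<phi>\<close> and the other outside \<open>D\<close>, only the tail \<open>k2\<close> matters.\<close>
  have kern: "1 / norm (x - y) powr q = k2 (y - x)" if "x \<in> ?B" "y \<notin> ?D" for x y
  proof -
    have "2 * \<rho> \<le> dist x0 y" "dist x0 x < \<rho>" using that by auto
    then have "\<rho> \<le> norm (y - x)"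
      using dist_triangle[of x0 y x] by (simp add: dist_norm norm_minus_commute)
    then show ?thesis by (simp add: k2_def powr_minus divide_inverse norm_minus_commute)
  qed
  have Hle: "\<bar>H x y\<bar> \<le> M * (indicator ?B x * k2 (y - x))" for x y
  proof (cases "x \<in> ?B \<and> y \<notin> ?D")
    case True
    have "\<bar>H x y\<bar> = \<phi> x * \<bar>v x - v y\<bar> * k2 (y - x)"
      using True \<phi>(2) k0 by (simp add: H_def kern[symmetric] abs_mult)
    also have "\<dots> \<le> 1 * M * k2 (y - x)"
    proof (intro mult_right_mono mult_mono)
      show "\<bar>v x - v y\<bar> \<le> M" using v(2)[of x] v(2)[of y] v(3)[of x] v(3)[of y] by linarith
    qed (use \<phi> k0 in auto)
    finally show ?thesis using True by simp
  next
    case False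
    then have "H x y = 0" using \<phi>(4) by (auto simp: H_def indicator_def)
    then show ?thesis using M0 k0 by simp
  qed
  note W2 = pair_integral_weighted_kernel[OF Bi mk(2) shift(1)[OF K2] k0(2) shift(2)[OF K2]]
  have Hi: "integrable ?L (\<lambda>(x, y). H x y)"
    by (rule Bochner_Integration.integrable_bound[OF integrable_mult_right[OF W2(1), of "M"] mH])
       (use Hle in \<open>auto intro!: AE_I2 intro: order_trans[OF _ abs_ge_self]\<close>)
  note W3 = pair_integral_weighted_kernel[OF \<phi>i mk(2) shift(1)[OF K2] k0(2) shift(2)[OF K2]]
  have mE: "(\<lambda>(x::'a, y). indicator E y :: real) \<in> borel_measurable ?L" by measurable
  have Ei: "integrable lborel (\<lambda>y. indicator E y :: real)"
    using E by (intro integrable_real_indicator) auto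
  have Ev: "(LINT y|lborel. indicator E y :: real) = measure lborel E" by simp
  note W4 = pair_integral_weighted_kernel[OF \<phi>i mE Ei _ Ev]
  define \<kappa> where "\<kappa> = d powr (- q)"
  have Hle2: "H x y \<le> V * (\<phi> x * k2 (y - x)) - m * \<kappa> * (\<phi> x * indicator E y)" for x y
  proof (cases "x \<in> ?B")
    case False
    then show ?thesis using \<phi>(4) by (simp add: H_def)
  next
    case x: True
    show ?thesis
    proof (cases "y \<in> ?D")
      case True
      then have "y \<notin> E" using E(3) by auto
      then show ?thesis using True pos \<phi>(2) k0 by (simp add: H_def)
    next
      case False
      have "m * \<kappa> * indicator E y \<le> v y * k2 (y - x)"
      proof (cases "y \<in> E")
        case True
        have "norm (x - y) > 0" using x False B_D by auto
        then have "\<kappa> \<le> norm (x - y) powr (- q)"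
          using E(5)[OF x True] pos unfolding \<kappa>_def dist_norm by (intro powr_mono2') auto
        also have "\<dots> = k2 (y - x)"
          using kern[OF x False] by (simp add: powr_minus divide_inverse)
        finally have "m * \<kappa> \<le> v y * k2 (y - x)"
          using E(4)[OF True] pos v(2) by (intro mult_mono) (auto simp: \<kappa>_def)
        then show ?thesis using True by simp
      qed (use v(2) k0 in simp)
      moreover have "v x * k2 (y - x) \<le> V * k2 (y - x)"
        using vV[OF x] k0 by (intro mult_right_mono) auto
      ultimately have "(v x - v y) * k2 (y - x) \<le> V * k2 (y - x) - m * \<kappa> * indicator E y"
        by (simp add: left_diff_distrib)
      then have "\<phi> x * ((v x - v y) * k2 (y - x)) \<le> \<phi> x * (V * k2 (y - x) - m * \<kappa> * indicator E y)"
        using \<phi>(2) by (rule mult_left_mono)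
      moreover have "H x y = \<phi> x * ((v x - v y) * k2 (y - x))"
        using False by (simp add: H_def kern[OF x False, symmetric])
      ultimately show ?thesis by (simp add: algebra_simps)
    qed
  qed
  have Hint: "(LINT z|?L. (case z of (x, y) \<Rightarrow> H x y)) \<le>
      (LINT x|lborel. \<phi> x) * (V * (LINT z|lborel. k2 z) - m * \<kappa> * measure lborel E)"
  proof -
    let ?W = "\<lambda>z. V * (case z of (x, y) \<Rightarrow> \<phi> x * k2 (y - x)) - m * \<kappa> * (case z of (x, y) \<Rightarrow> \<phi> x * indicator E y)"
    have W4': "integrable ?L (\<lambda>(x, y). \<phi> x * indicator E y)"
      "(LINT z|?L. (case z of (x, y) \<Rightarrow> \<phi> x * indicator E y)) = (LINT x|lborel. \<phi> x) * measure lborel E"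
      using W4 by auto
    have "(LINT z|?L. (case z of (x, y) \<Rightarrow> H x y)) \<le> (LINT z|?L. ?W z)"
      by (rule integral_mono[OF Hi])
         (use Hle2 W3(1) W4'(1) in \<open>auto intro!: Bochner_Integration.integrable_diff integrable_mult_right\<close>)
    also have "\<dots> = V * ((LINT x|lborel. \<phi> x) * (LINT z|lborel. k2 z)) - m * \<kappa> * ((LINT x|lborel. \<phi> x) * measure lborel E)"
      using W3 W4' by (subst Bochner_Integration.integral_diff) auto
    finally show ?thesis by (simp add: algebra_simps)
  qed
  have Hi': "integrable ?L (\<lambda>(x, y). H y x)"
    using lborel_pair.integrable_product_swap[OF Hi] by (simp add: case_prod_beta')
  have Hint': "(LINT z|?L. (case z of (x, y) \<Rightarrow> H y x)) = (LINT z|?L. (case z of (x, y) \<Rightarrow> H x y))"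
    using lborel_pair.integral_product_swap[OF mH] by (simp add: case_prod_beta')
  have eqF: "(\<lambda>(x, y). F x y) = (\<lambda>z. (case z of (x, y) \<Rightarrow> N x y) + (case z of (x, y) \<Rightarrow> H x y) + (case z of (x, y) \<Rightarrow> H y x))"
    by (auto simp: split fun_eq_iff)
  have Fi: "integrable ?L (\<lambda>(x, y). F x y)"
    unfolding eqF by (intro Bochner_Integration.integrable_add Ni Hi Hi')
  have "(LINT y|lborel. LINT x|lborel. F x y) = (LINT z|?L. (case z of (x, y) \<Rightarrow> F x y))"
    by (rule lborel_pair.integral_snd[OF Fi])
  also have "\<dots> = (LINT z|?L. (case z of (x, y) \<Rightarrow> N x y)) + 2 * (LINT z|?L. (case z of (x, y) \<Rightarrow> H x y))"
    unfolding eqF using Ni Hi Hi' Hint'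
    by (subst Bochner_Integration.integral_add, (intro Bochner_Integration.integrable_add Ni Hi Hi')+)
       (subst Bochner_Integration.integral_add, auto)
  also have "\<dots> \<le> measure lborel ?D * (\<Lambda> * \<Gamma>) * (LINT z|lborel. k1 z) +
     2 * ((LINT x|lborel. \<phi> x) * (V * (LINT z|lborel. k2 z) - m * \<kappa> * measure lborel E))"
    using Nint Hint by (simp add: algebra_simps)
  finally show ?thesis unfolding F_def k1_def k2_def \<kappa>_def .
qed

section \<open>Twice differentiable functions at a minimum\<close>

text \<open>
  The second derivative test along a coordinate line: if the second derivative were negative, the
  first one would be negative just to the right of \<open>x0\<close>, and \<open>u\<close> would drop below its minimum.
\<close>

lemma partials_at_interior_minimum:
  fixes u :: "real^'n \<Rightarrow> real"
  assumes "open \<Omega>" and C2: "Ck_on 2 \<Omega> u" and "x0 \<in> \<Omega>" and min: "\<And>x. x \<in> \<Omega> \<Longrightarrow> u x0 \<le> u x"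
  shows "partial i u x0 = 0" and "0 \<le> partial i (partial i u) x0"
proof -
  let ?e = "axis i 1 :: real^'n"
  obtain r where r: "0 < r" "ball x0 r \<subseteq> \<Omega>"
    using assms(1,3) openE by blast
  have inside: "x0 + t *\<^sub>R ?e \<in> \<Omega>" if "\<bar>t\<bar> < r" for t
    using that r(2) by (auto simp: dist_norm)
  define h where "h t = u (x0 + t *\<^sub>R ?e)" for t
  have d1: "(h has_real_derivative partial i u (x0 + t *\<^sub>R ?e)) (at t)" if "\<bar>t\<bar> < r" for t
    unfolding h_def by (rule partial_has_real_derivative) (use inside[OF that] C2 in \<open>auto simp: numeral_2_eq_2\<close>)
  have d2: "((\<lambda>t. partial i u (x0 + t *\<^sub>R ?e)) has_real_derivative partial i (partial i u) x0) (at 0)"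
    using partial_has_real_derivative[of "partial i u" x0 0 i] C2 assms(3) by (auto simp: numeral_2_eq_2)
  have hmin: "h 0 \<le> h t" if "\<bar>t\<bar> < r" for t
    using min[OF inside[OF that]] by (simp add: h_def)
  show p0: "partial i u x0 = 0"
    using DERIV_local_min[OF d1[of 0] r(1)] hmin r(1) by auto
  show "0 \<le> partial i (partial i u) x0"
  proof (rule ccontr)
    assume "\<not> 0 \<le> partial i (partial i u) x0"
    then obtain d where d: "d > 0" "\<And>t. 0 < t \<Longrightarrow> t < d \<Longrightarrow> partial i u (x0 + t *\<^sub>R ?e) < 0"
      using DERIV_neg_dec_right[OF d2] p0 by auto
    define t where "t = min d r / 2"
    have t: "0 < t" "t < d" "t < r" using d(1) r(1) by (auto simp: t_def min_def)
    obtain z where z: "0 < z" "z < t" "h t - h 0 = (t - 0) * partial i u (x0 + z *\<^sub>R ?e)"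
      using MVT2[OF t(1), of h "\<lambda>t. partial i u (x0 + t *\<^sub>R ?e)"] d1 t by fastforce
    have "h t - h 0 < 0"
      unfolding z(3) using d(2)[of z] z t by (simp add: mult_pos_neg)
    with hmin[of t] t show False by simp
  qed
qed

lemma linear_growth_at_zero:
  assumes "f differentiable (at x0)" "f x0 = (0::real)"
  shows "\<exists>C\<ge>0. \<exists>r>0. \<forall>x\<in>ball x0 r. \<bar>f x\<bar> \<le> C * dist x x0"
proof -
  obtain D where D: "(f has_derivative D) (at x0)" using assms(1) by (auto simp: differentiable_def)
  then have bl: "bounded_linear D" by (rule has_derivative_bounded_linear)
  obtain r where r: "0 < r" "\<And>x. norm (x - x0) < r \<Longrightarrow> norm (f x - f x0 - D (x - x0)) \<le> 1 * norm (x - x0)"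
    using D unfolding has_derivative_at_alt by (meson zero_less_one)
  have "\<bar>f x\<bar> \<le> (1 + onorm D) * dist x x0" if "x \<in> ball x0 r" for x
  proof -
    have "\<bar>f x\<bar> \<le> norm (f x - f x0 - D (x - x0)) + norm (D (x - x0))"
      using assms(2) by simp
    also have "\<dots> \<le> 1 * norm (x - x0) + onorm D * norm (x - x0)"
      using that by (intro add_mono r(2) onorm[OF bl]) (simp add: dist_norm norm_minus_commute)
    finally show ?thesis by (simp add: dist_norm algebra_simps)
  qed
  then show ?thesis using onorm_pos_le[OF bl] r(1) by (intro exI[of _ "1 + onorm D"]) auto
qed

text \<open>
  The gradient vanishes at \<open>x0\<close> and is differentiable there, hence it is of size \<open>O(\<rho>)\<close> on the ball of
  radius \<open>\<rho>\<close>; the mean value inequality does the rest. The factor \<open>\<rho>\<close> is what balances the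
  Lipschitz constant of order \<open>1 / \<rho>\<close> of the bumps.
\<close>

lemma C2_lipschitz_at_critical_point:
  fixes u :: "real^'n \<Rightarrow> real"
  assumes "open \<Omega>" and C2: "Ck_on 2 \<Omega> u" and "x0 \<in> \<Omega>" and crit: "\<And>i. partial i u x0 = 0"
  shows "\<exists>C\<ge>0. \<exists>r>0. ball x0 r \<subseteq> \<Omega> \<and>
    (\<forall>\<rho>\<le>r. \<forall>x\<in>ball x0 \<rho>. \<forall>y\<in>ball x0 \<rho>. \<bar>u x - u y\<bar> \<le> C * \<rho> * dist x y)"
proof -
  have "\<exists>C\<ge>0. \<exists>r>0. \<forall>x\<in>ball x0 r. \<bar>partial i u x\<bar> \<le> C * dist x x0" for i
    by (rule linear_growth_at_zero) (use C2 assms(3) crit in \<open>auto simp: numeral_2_eq_2\<close>)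
  then obtain C r where Cr: "\<And>i. 0 \<le> C i" "\<And>i. 0 < r i"
    "\<And>i x. x \<in> ball x0 (r i) \<Longrightarrow> \<bar>partial i u x\<bar> \<le> C i * dist x x0"
    by metis
  obtain r' where r': "0 < r'" "ball x0 r' \<subseteq> \<Omega>" using assms(1,3) openE by blast
  define R where "R = min r' (Min (range r))"
  have "0 < Min (range r)" using Cr(2) by (subst Min_gr_iff) auto
  then have R: "0 < R" "R \<le> r'" "\<And>i. R \<le> r i" using r'(1) by (auto simp: R_def min.coboundedI2)
  define B where "B = (\<Sum>i\<in>UNIV. C i)"
  have B: "0 \<le> B" unfolding B_def by (intro sum_nonneg Cr(1))
  have "\<bar>u x - u y\<bar> \<le> B * \<rho> * dist x y" if \<rho>: "\<rho> \<le> R" and xy: "x \<in> ball x0 \<rho>" "y \<in> ball x0 \<rho>" for \<rho> x y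
  proof -
    have "norm (u x - u y) \<le> B * \<rho> * norm (x - y)"
    proof (rule differentiable_bound[OF convex_ball _ _ xy, where f' = "\<lambda>z. frechet_derivative u (at z)"])
      fix z assume z: "z \<in> ball x0 \<rho>"
      then have z\<Omega>: "z \<in> \<Omega>" using \<rho> R(2) r'(2) by auto
      then have D: "(u has_derivative frechet_derivative u (at z)) (at z)"
        using C2 by (simp add: numeral_2_eq_2 frechet_derivative_works)
      then show "(u has_derivative frechet_derivative u (at z)) (at z within ball x0 \<rho>)"
        by (rule has_derivative_at_withinI)
      show "onorm (frechet_derivative u (at z)) \<le> B * \<rho>"
      proof (rule onorm_le)
        fix h :: "real^'n"
        have lin: "linear (frechet_derivative u (at z))" by (rule has_derivative_linear[OF D])
        have "h = (\<Sum>i\<in>UNIV. h $ i *\<^sub>R axis i 1)"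
          by (simp add: vec_eq_iff axis_def if_distrib cong: if_cong)
        then have "frechet_derivative u (at z) h =
            frechet_derivative u (at z) (\<Sum>i\<in>UNIV. h $ i *\<^sub>R axis i 1)"
          by (rule arg_cong)
        also have "\<dots> = (\<Sum>i\<in>UNIV. frechet_derivative u (at z) (h $ i *\<^sub>R axis i 1))"
          by (rule linear_sum[OF lin])
        also have "\<dots> = (\<Sum>i\<in>UNIV. h $ i * partial i u z)"
          by (simp add: partial_def linear_scale[OF lin])
        also have "norm \<dots> \<le> (\<Sum>i\<in>UNIV. norm h * (C i * \<rho>))"
        proof (rule sum_norm_le)
          fix i :: 'n
          have "dist z x0 \<le> \<rho>" using z by (simp add: dist_commute)
          then have "\<bar>partial i u z\<bar> \<le> C i * \<rho>"
            using Cr(3)[of z i] z \<rho> R(3)[of i] Cr(1)[of i]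
            by (intro order_trans[OF Cr(3) mult_left_mono]) auto
          then show "norm (h $ i * partial i u z) \<le> norm h * (C i * \<rho>)"
            unfolding norm_mult by (intro mult_mono) (auto simp: component_le_norm_cart)
        qed
        also have "\<dots> = B * \<rho> * norm h"
          by (simp add: B_def sum_distrib_left sum_distrib_right mult_ac)
        finally show "norm (frechet_derivative u (at z) h) \<le> B * \<rho> * norm h" .
      qed
    qed
    then show ?thesis by (simp add: dist_norm)
  qed
  then show ?thesis using B R r'(2) by (intro exI[of _ B] conjI exI[of _ R]) auto
qed

section \<open>Bumps concentrating at a point\<close>

text \<open>
  The half side length \<open>\<epsilon>\<close> of the box is \<open>\<rho> / n\<close> so that the box lies in the ball of radius \<open>\<rho>\<close>,
  and the steepness \<open>1 / \<epsilon>\<close> makes all these functions rescaled copies of one profile.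
\<close>

definition bump :: "real^'n \<Rightarrow> real \<Rightarrow> real^'n \<Rightarrow> real" where
  "bump x0 \<rho> = (let \<epsilon> = \<rho> / real CARD('n) in box_bump (1 / \<epsilon>) (x0 - vec \<epsilon>) (x0 + vec \<epsilon>))"

lemma bump_support:
  fixes x0 :: "real^'n"
  assumes "0 < \<rho>" "x \<notin> ball x0 \<rho>"
  shows "bump x0 \<rho> x = 0"
proof -
  define \<epsilon> where "\<epsilon> = \<rho> / real CARD('n)"
  have e: "0 < \<epsilon>" using assms(1) by (simp add: \<epsilon>_def)
  have "x \<notin> box (x0 - vec \<epsilon>) (x0 + vec \<epsilon>)"
  proof
    assume "x \<in> box (x0 - vec \<epsilon>) (x0 + vec \<epsilon>)"
    then have "\<bar>(x0 - x) $ i\<bar> < \<epsilon>" for i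
      by (auto simp: mem_box_cart abs_less_iff algebra_simps)
    then have "(\<Sum>i\<in>UNIV. \<bar>(x0 - x) $ i\<bar>) < (\<Sum>i\<in>(UNIV::'n set). \<epsilon>)"
      by (intro sum_strict_mono) auto
    then have "norm (x0 - x) < \<rho>"
      using norm_le_l1_cart[of "x0 - x"] by (simp add: \<epsilon>_def)
    with assms(2) show False by (simp add: dist_norm)
  qed
  then show ?thesis
    using e by (simp add: bump_def \<epsilon>_def[symmetric] Let_def box_bump_eq_0)
qed

lemma bump_bounds: "0 \<le> bump x0 \<rho> x" "bump x0 \<rho> x \<le> 1"
  by (simp_all add: bump_def Let_def box_bump_bounds)

lemma bump_lipschitz:
  fixes x0 :: "real^'n"
  assumes "0 < \<rho>"
  shows "\<bar>bump x0 \<rho> x - bump x0 \<rho> y\<bar> \<le> 4 * (real CARD('n))\<^sup>2 / \<rho> * dist x y"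
  using box_bump_lipschitz[of "1 / (\<rho> / real CARD('n))" "x0 - vec (\<rho> / real CARD('n))"
      "x0 + vec (\<rho> / real CARD('n))" x y] assms
  by (simp add: bump_def Let_def power2_eq_square)

lemma test_function_bump:
  fixes x0 :: "real^'n"
  assumes "0 < \<rho>" "cball x0 \<rho> \<subseteq> \<Omega>"
  shows "test_function \<Omega> (bump x0 \<rho>)"
proof -
  define \<epsilon> where "\<epsilon> = \<rho> / real CARD('n)"
  have e: "0 < \<epsilon>" using assms(1) by (simp add: \<epsilon>_def)
  have "cbox (x0 - vec \<epsilon>) (x0 + vec \<epsilon>) \<subseteq> cball x0 \<rho>"
  proof
    fix x assume "x \<in> cbox (x0 - vec \<epsilon>) (x0 + vec \<epsilon>)"
    then have "\<bar>(x0 - x) $ i\<bar> \<le> \<epsilon>" for i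
      by (auto simp: mem_box_cart abs_le_iff algebra_simps)
    then have "(\<Sum>i\<in>UNIV. \<bar>(x0 - x) $ i\<bar>) \<le> (\<Sum>i\<in>(UNIV::'n set). \<epsilon>)"
      by (intro sum_mono) auto
    then have "norm (x0 - x) \<le> \<rho>"
      using norm_le_l1_cart[of "x0 - x"] by (simp add: \<epsilon>_def)
    then show "x \<in> cball x0 \<rho>" by (simp add: dist_norm)
  qed
  then show ?thesis
    using e assms(2) test_function_box_bump[of "1 / \<epsilon>" "x0 - vec \<epsilon>" "x0 + vec \<epsilon>" \<Omega>]
    by (simp add: bump_def \<epsilon>_def[symmetric] Let_def)
qed

lemma bump_continuous:
  assumes "0 < \<rho>"
  shows "continuous_on UNIV (bump x0 \<rho>)"
  by (rule test_function_continuous[OF test_function_bump[OF assms subset_UNIV]])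

lemma bump_integrable:
  assumes "0 < \<rho>"
  shows "integrable lborel (bump x0 \<rho>)"
proof (rule compact_support_integrable_bounded(1)[OF bump_continuous[OF assms] compact_cball])
  show "bump x0 \<rho> x = 0" if "x \<notin> cball x0 \<rho>" for x
    using bump_support[OF assms, of x x0] that by auto
qed

text \<open>
  On the box of half the size all factors of the bump are at least \<open>exp (- 2)\<close>. A lower bound of the
  correct order in \<open>\<rho>\<close> is all that is needed to absorb error terms into the integral of the bump.
\<close>

lemma bump_integral_lower_bound:
  "\<exists>c>0. \<forall>\<rho>>0. \<forall>x0::real^'n. c * \<rho> ^ CARD('n) \<le> (LINT x|lborel. bump x0 \<rho> x)"
proof -
  let ?n = "CARD('n)"
  define c where "c = exp (- 4) ^ ?n * (1 / real ?n) ^ ?n"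
  have "c > 0" by (simp add: c_def)
  moreover have "c * \<rho> ^ ?n \<le> (LINT x|lborel. bump x0 \<rho> x)" if "\<rho> > 0" for \<rho> and x0 :: "real^'n"
  proof -
    define \<epsilon> where "\<epsilon> = \<rho> / real ?n"
    have e: "0 < \<epsilon>" using that by (simp add: \<epsilon>_def)
    let ?Q = "cbox (x0 - vec (\<epsilon> / 2)) (x0 + vec (\<epsilon> / 2))"
    have flat: "exp (- 2) \<le> flat_exp 0 t" if "1 / 2 \<le> t" for t
      using that by (simp add: flat_exp_def field_simps)
    have low: "exp (- 4) ^ ?n \<le> bump x0 \<rho> x" if "x \<in> ?Q" for x
    proof -
      have "(\<Prod>i\<in>(UNIV::'n set). exp (- 4)) \<le> (bump x0 \<rho> x :: real)"
        unfolding bump_def Let_def \<epsilon>_def[symmetric] box_bump_def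
      proof (rule prod_mono, intro conjI)
        fix i :: 'n
        have "x0 $ i - \<epsilon> / 2 \<le> x $ i" "x $ i \<le> x0 $ i + \<epsilon> / 2"
          using that by (auto simp: mem_box_cart)
        then have "1 / 2 \<le> 1 / \<epsilon> * (x $ i - (x0 - vec \<epsilon>) $ i)" "1 / 2 \<le> 1 / \<epsilon> * ((x0 + vec \<epsilon>) $ i - x $ i)"
          using e by (simp_all add: field_simps)
        then have "exp (- 2) * exp (- 2) \<le>
            flat_exp 0 (1 / \<epsilon> * (x $ i - (x0 - vec \<epsilon>) $ i)) * flat_exp 0 (1 / \<epsilon> * ((x0 + vec \<epsilon>) $ i - x $ i))"
          by (intro mult_mono flat) (auto simp: flat_exp_0_bounds)
        then show "exp (- 4) \<le>
            flat_exp 0 (1 / \<epsilon> * (x $ i - (x0 - vec \<epsilon>) $ i)) * flat_exp 0 (1 / \<epsilon> * ((x0 + vec \<epsilon>) $ i - x $ i))"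
          by (simp add: exp_add[symmetric])
      qed simp
      then show ?thesis by simp
    qed
    have vol: "measure lborel ?Q = \<epsilon> ^ ?n"
      using e content_cbox_cart[of "x0 - vec (\<epsilon> / 2)" "x0 + vec (\<epsilon> / 2)"]
      by (simp add: interval_eq_empty_cart)
    have Qi: "integrable lborel (\<lambda>x. indicator ?Q x * exp (- 4) ^ ?n :: real)"
      by (intro integrable_mult_left integrable_real_indicator) (auto simp: emeasure_lborel_cbox_eq)
    have "c * \<rho> ^ ?n = measure lborel ?Q * exp (- 4) ^ ?n"
      unfolding vol by (simp add: c_def \<epsilon>_def power_divide)
    also have "\<dots> = (LINT x|lborel. indicator ?Q x * exp (- 4) ^ ?n)"
      by simp
    also have "\<dots> \<le> (LINT x|lborel. bump x0 \<rho> x)"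
      by (rule integral_mono[OF Qi bump_integrable[OF that]])
         (use low bump_bounds in \<open>auto simp: indicator_def\<close>)
    finally show ?thesis .
  qed
  ultimately show ?thesis by blast
qed

section \<open>The nonlocal term at a zero\<close>

text \<open>
  A change of \<open>u\<close> on a null set affects the inner integral for \<open>y\<close> in a null set only. With a Borel
  representative \<open>v\<close> and the measure \<open>lborel\<close>, the integrand is measurable for the product measure and
  Fubini's theorem applies.
\<close>

lemma iterated_lebesgue_integral_gagliardo_AE:
  fixes u v \<phi> :: "'a::euclidean_space \<Rightarrow> real"
  assumes u: "u \<in> borel_measurable lebesgue" and v: "v \<in> borel_measurable borel"
    and \<phi>: "\<phi> \<in> borel_measurable borel" and ae: "AE x in lebesgue. u x = v x"
  shows "(LINT y|lebesgue. LINT x|lebesgue. gagliardo q u \<phi> x y) =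
    (LINT y|lborel. LINT x|lborel. gagliardo q v \<phi> x y)"
proof -
  have [measurable]: "v \<in> borel_measurable borel" "\<phi> \<in> borel_measurable borel" by fact+
  have mv: "(\<lambda>(y, x). gagliardo q v \<phi> x y) \<in> borel_measurable (lborel \<Otimes>\<^sub>M lborel)"
    unfolding gagliardo_def by measurable
  have m1: "(\<lambda>x. gagliardo q v \<phi> x y) \<in> borel_measurable lborel" for y
    unfolding gagliardo_def by measurable
  have mo: "(\<lambda>y. LINT x|lborel. gagliardo q v \<phi> x y) \<in> borel_measurable lborel"
    using lborel.borel_measurable_lebesgue_integral[OF mv] by simp
  have inner: "(LINT x|lebesgue. gagliardo q u \<phi> x y) = (LINT x|lborel. gagliardo q v \<phi> x y)" if "u y = v y" for y
  proof -
    have "(LINT x|lebesgue. gagliardo q u \<phi> x y) = (LINT x|lebesgue. gagliardo q v \<phi> x y)"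
    proof (rule integral_cong_AE)
      have k: "(\<lambda>x. (\<phi> x - \<phi> y) / norm (x - y) powr q) \<in> borel_measurable lebesgue"
        by (rule measurable_completion) measurable
      have "(\<lambda>x. (u x - u y) * ((\<phi> x - \<phi> y) / norm (x - y) powr q)) \<in> borel_measurable lebesgue"
        by (intro borel_measurable_times borel_measurable_diff u k borel_measurable_const)
      then show "(\<lambda>x. gagliardo q u \<phi> x y) \<in> borel_measurable lebesgue"
        by (simp add: gagliardo_def)
      show "(\<lambda>x. gagliardo q v \<phi> x y) \<in> borel_measurable lebesgue"
        by (rule measurable_completion[OF m1])
      show "AE x in lebesgue. gagliardo q u \<phi> x y = gagliardo q v \<phi> x y"
        using ae by eventually_elim (simp add: gagliardo_def that)
    qed
    also have "\<dots> = (LINT x|lborel. gagliardo q v \<phi> x y)"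
      by (rule integral_completion[OF m1])
    finally show ?thesis .
  qed
  have ae2: "AE y in lebesgue. (LINT x|lborel. gagliardo q v \<phi> x y) = (LINT x|lebesgue. gagliardo q u \<phi> x y)"
    using ae by eventually_elim (simp add: inner)
  have mo': "(\<lambda>y. LINT x|lborel. gagliardo q v \<phi> x y) \<in> borel_measurable lebesgue"
    by (rule measurable_completion[OF mo])
  have "(LINT y|lebesgue. LINT x|lebesgue. gagliardo q u \<phi> x y) = (LINT y|lebesgue. LINT x|lborel. gagliardo q v \<phi> x y)"
    by (rule integral_cong_AE[OF borel_measurable_AE[OF mo' ae2] mo']) (use ae2 in eventually_elim, simp)
  also have "\<dots> = (LINT y|lborel. LINT x|lborel. gagliardo q v \<phi> x y)"
    by (rule integral_completion[OF mo])
  finally show ?thesis .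
qed

text \<open>
  In the bound for the form, the interactions close to \<open>x0\<close> have the size
  \<open>\<rho>^n (1/\<rho>) \<rho> \<rho>^(2-2s)\<close>, and \<open>\<rho>^n\<close> is absorbed by the integral of the bump; the term with \<open>V = O(\<rho>\<^sup>2)\<close>
  meets a tail of size \<open>\<rho>^(-2s)\<close>. Both vanish relative to the fixed negative contribution of the ball
  around \<open>y0\<close> as \<open>\<rho> \<rightarrow> 0\<close>, because \<open>s < 1\<close>.
\<close>

lemma nonlocal_form_negative_at_zero:
  fixes v :: "real^'n \<Rightarrow> real"
  assumes n: "2 \<le> CARD('n)" and s: "0 < s" "s < 1"
    and v: "v \<in> borel_measurable borel" "\<And>x. 0 \<le> v x" "\<And>x. v x \<le> M"
    and x0: "v x0 = 0" and C: "0 \<le> C" "0 < r"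
      "\<And>\<rho> x y. \<rho> \<le> r \<Longrightarrow> x \<in> ball x0 \<rho> \<Longrightarrow> y \<in> ball x0 \<rho> \<Longrightarrow> \<bar>v x - v y\<bar> \<le> C * \<rho> * dist x y"
    and E: "0 < r1" "0 < m" "\<And>y. y \<in> cball y0 r1 \<Longrightarrow> m \<le> v y" "y0 \<noteq> x0" "2 * r1 \<le> dist x0 y0"
  shows "\<exists>c>0. \<forall>\<^sub>F \<rho> in at_right 0.
    (LINT y|lborel. LINT x|lborel. gagliardo (real CARD('n) + 2 * s) v (bump x0 \<rho>) x y)
      \<le> - c * (LINT x|lborel. bump x0 \<rho> x)"
proof -
  let ?n = "CARD('n)"
  define q where "q = real ?n + 2 * s"
  define d where "d = 2 * dist x0 y0 + r1"
  have dp: "dist x0 y0 > 0" using E(4) by simp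
  then have d: "0 < d" using E(1) unfolding d_def by linarith
  obtain A1 where A1: "A1 \<ge> 0" "\<And>R. R > 0 \<Longrightarrow> integrable lborel (\<lambda>z::real^'n. indicator (ball 0 R) z * norm z powr (2 - q))"
    "\<And>R. R > 0 \<Longrightarrow> (LINT z::real^'n|lborel. indicator (ball 0 R) z * norm z powr (2 - q)) \<le> A1 * R powr (2 - 2 * s)"
    using kernel_near[where 'a = "real^'n", of "q - 2"] n s by (auto simp: q_def)
  obtain A2 where A2: "A2 \<ge> 0" "\<And>R. R > 0 \<Longrightarrow> integrable lborel (\<lambda>z::real^'n. indicator (- ball 0 R) z * norm z powr (- q))"
    "\<And>R. R > 0 \<Longrightarrow> (LINT z::real^'n|lborel. indicator (- ball 0 R) z * norm z powr (- q)) \<le> A2 * R powr (- 2 * s)"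
    using kernel_far[where 'a = "real^'n", of "q"] n s by (auto simp: q_def)
  obtain c0 where c0: "c0 > 0" "\<And>\<rho>. \<rho> > 0 \<Longrightarrow> c0 * \<rho> ^ ?n \<le> (LINT x|lborel. bump x0 \<rho> x)"
    using bump_integral_lower_bound[where 'n = 'n] by blast
  define \<omega> where "\<omega> = unit_ball_vol (real ?n)"
  have \<omega>: "0 \<le> \<omega>" by (simp add: \<omega>_def)
  \<comment> \<open>\<open>c1\<close> collects the errors of order \<open>\<rho>^(2-2s)\<close>, \<open>c2\<close> is the gain from the ball around \<open>y0\<close>.\<close>
  define c1 where "c1 = \<omega> * 2 ^ ?n / c0 * (8 * (real ?n)\<^sup>2 * C) * A1 * 4 powr (2 - 2 * s) + 4 * C * A2"
  define c2 where "c2 = 2 * (m * d powr (- q) * measure lborel (cball y0 r1))"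
  have c1: "0 \<le> c1" unfolding c1_def using \<omega> c0(1) C(1) A1(1) A2(1) by (intro add_nonneg_nonneg mult_nonneg_nonneg) auto
  have c2: "0 < c2" using E(1,2) d by (simp add: c2_def content_cball_pos)
  have main: "(LINT y|lborel. LINT x|lborel. gagliardo q v (bump x0 \<rho>) x y)
      \<le> (c1 * \<rho> powr (2 - 2 * s) - c2) * (LINT x|lborel. bump x0 \<rho> x)"
    if \<rho>: "0 < \<rho>" "2 * \<rho> \<le> r" "4 * \<rho> \<le> dist x0 y0" for \<rho>
  proof -
    define I where "I = (LINT x|lborel. bump x0 \<rho> x)"
    define \<Lambda> where "\<Lambda> = 4 * (real ?n)\<^sup>2 / \<rho>"
    define \<Gamma> where "\<Gamma> = C * (2 * \<rho>)"
    define V where "V = C * (2 * \<rho>) * \<rho>"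
    define J1 where "J1 = (LINT z::real^'n|lborel. indicator (ball 0 (4 * \<rho>)) z * norm z powr (2 - q))"
    define J2 where "J2 = (LINT z::real^'n|lborel. indicator (- ball 0 \<rho>) z * norm z powr (- q))"
    have I: "c0 * \<rho> ^ ?n \<le> I" "0 \<le> I"
      using c0(2)[OF \<rho>(1)] unfolding I_def by (auto intro!: Bochner_Integration.integral_nonneg bump_bounds)
    have bm: "bump x0 \<rho> \<in> borel_measurable borel"
      by (rule borel_measurable_continuous_onI[OF bump_continuous[OF \<rho>(1)]])
    have "(LINT y|lborel. LINT x|lborel. gagliardo q v (bump x0 \<rho>) x y) \<le>
     measure lborel (ball x0 (2 * \<rho>)) * (\<Lambda> * \<Gamma>) * J1 +
     2 * (I * (V * J2 - m * d powr (- q) * measure lborel (cball y0 r1)))"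
      unfolding I_def J1_def J2_def
    proof (rule gagliardo_form_upper_bound[OF v bm bump_bounds bump_support[OF \<rho>(1)]])
      show "\<bar>bump x0 \<rho> x - bump x0 \<rho> y\<bar> \<le> \<Lambda> * dist x y" for x y
        unfolding \<Lambda>_def by (rule bump_lipschitz[OF \<rho>(1)])
      show "\<bar>v x - v y\<bar> \<le> \<Gamma> * dist x y" if "x \<in> ball x0 (2 * \<rho>)" "y \<in> ball x0 (2 * \<rho>)" for x y
        unfolding \<Gamma>_def by (rule C(3)[OF \<rho>(2) that])
      show "v x \<le> V" if "x \<in> ball x0 \<rho>" for x
      proof -
        have "v x \<le> \<bar>v x - v x0\<bar>" by (simp add: x0)
        also have "\<dots> \<le> C * (2 * \<rho>) * dist x x0"
          using that \<rho> by (intro C(3)) auto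
        also have "\<dots> \<le> V"
          unfolding V_def using that \<rho> C(1) by (intro mult_left_mono) (auto simp: dist_commute)
        finally show ?thesis .
      qed
      show "cball y0 r1 \<inter> ball x0 (2 * \<rho>) = {}"
      proof -
        have False if "dist y0 y \<le> r1" "dist x0 y < 2 * \<rho>" for y
          using dist_triangle2[of x0 y0 y] that E(5) \<rho>(3) by (simp add: dist_commute)
        then show ?thesis by (auto simp: dist_commute)
      qed
      show "dist x y \<le> d" if "x \<in> ball x0 \<rho>" "y \<in> cball y0 r1" for x y
      proof -
        have "dist x y \<le> dist x x0 + (dist x0 y0 + dist y0 y)"
          using dist_triangle[of x y x0] dist_triangle[of x0 y y0] by linarith
        moreover have "dist x x0 \<le> dist x0 y0" using that(1) \<rho> by (simp add: dist_commute)
        ultimately show ?thesis using that(2) by (simp add: d_def)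
      qed
      show "integrable lborel (\<lambda>z::real^'n. indicator (ball 0 (4 * \<rho>)) z * norm z powr (2 - q))"
        by (rule A1(2)) (use \<rho> in simp)
      show "integrable lborel (\<lambda>z::real^'n. indicator (- ball 0 \<rho>) z * norm z powr (- q))"
        by (rule A2(2)) (use \<rho> in simp)
    qed (use \<rho> C(1) E d s in \<open>auto simp: \<Lambda>_def \<Gamma>_def V_def q_def emeasure_cball\<close>)
    also have "\<dots> \<le> (\<omega> * 2 ^ ?n / c0 * I) * (8 * (real ?n)\<^sup>2 * C) * (A1 * (4 powr (2 - 2 * s) * \<rho> powr (2 - 2 * s))) +
     2 * (I * (2 * C * A2 * \<rho> powr (2 - 2 * s) - m * d powr (- q) * measure lborel (cball y0 r1)))"
    proof -
      have b1: "measure lborel (ball x0 (2 * \<rho>)) \<le> \<omega> * 2 ^ ?n / c0 * I"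
      proof -
        have "measure lborel (ball x0 (2 * \<rho>)) = \<omega> * (2 * \<rho>) ^ ?n"
          using \<rho> content_ball[of "2 * \<rho>" x0] by (simp add: \<omega>_def)
        also have "\<dots> = \<omega> * 2 ^ ?n / c0 * (c0 * \<rho> ^ ?n)"
          using c0(1) by (simp add: power_mult_distrib)
        also have "\<dots> \<le> \<omega> * 2 ^ ?n / c0 * I"
          using I(1) \<omega> c0(1) by (intro mult_left_mono) auto
        finally show ?thesis .
      qed
      have b2: "\<Lambda> * \<Gamma> \<le> 8 * (real ?n)\<^sup>2 * C"
        using \<rho> by (simp add: \<Lambda>_def \<Gamma>_def field_simps)
      have b3: "J1 \<le> A1 * (4 powr (2 - 2 * s) * \<rho> powr (2 - 2 * s))"
        using A1(3)[of "4 * \<rho>"] \<rho> by (simp add: J1_def powr_mult)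
      have "V * J2 \<le> V * (A2 * \<rho> powr (- 2 * s))"
        using A2(3)[OF \<rho>(1)] \<rho> C(1) by (intro mult_left_mono) (auto simp: J2_def V_def)
      also have "\<dots> = 2 * C * A2 * (\<rho> powr 2 * \<rho> powr (- 2 * s))"
        using \<rho> by (simp add: V_def power2_eq_square)
      also have "\<dots> = 2 * C * A2 * \<rho> powr (2 - 2 * s)"
        by (simp only: powr_add[symmetric]) simp
      finally have b4: "V * J2 \<le> 2 * C * A2 * \<rho> powr (2 - 2 * s)" .
      have n1: "0 \<le> J1" unfolding J1_def by (rule Bochner_Integration.integral_nonneg) auto
      have n2: "0 \<le> \<Lambda> * \<Gamma>" using \<rho> C(1) by (simp add: \<Lambda>_def \<Gamma>_def)
      have n3: "0 \<le> \<omega> * 2 ^ ?n / c0 * I" using \<omega> c0(1) I(2) by simp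
      have n4: "0 \<le> 8 * (real ?n)\<^sup>2 * C" using C(1) by simp
      show ?thesis
        by (intro add_mono mult_mono[OF mult_mono[OF b1 b2 n3 n2] b3 mult_nonneg_nonneg[OF n3 n4] n1]
            mult_left_mono diff_mono b4 order_refl) (use I in auto)
    qed
    also have "\<dots> = (c1 * \<rho> powr (2 - 2 * s) - c2) * I"
      by (simp add: c1_def c2_def algebra_simps)
    finally show ?thesis unfolding I_def .
  qed
  have "\<forall>\<^sub>F \<rho> in at_right (0::real). 0 \<le> \<rho>"
    using eventually_at_right_less[of "0::real"] by eventually_elim simp
  then have lim: "((\<lambda>\<rho>. c1 * \<rho> powr (2 - 2 * s)) \<longlongrightarrow> c1 * 0 powr (2 - 2 * s)) (at_right 0)"
    by (intro tendsto_mult tendsto_const tendsto_powr' tendsto_ident_at) (use s in auto)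
  have "\<forall>\<^sub>F \<rho> in at_right 0. c1 * \<rho> powr (2 - 2 * s) < c2 / 2"
    by (rule order_tendstoD(2)[OF lim]) (use c2 in simp)
  moreover have "\<forall>\<^sub>F \<rho> in at_right 0. 0 < \<rho> \<and> \<rho> < min (r / 2) (dist x0 y0 / 4)"
    by (rule eventually_at_right_real[of 0 "min (r / 2) (dist x0 y0 / 4)", THEN eventually_mono])
       (use C(2) dp in auto)
  ultimately have "\<forall>\<^sub>F \<rho> in at_right 0.
    (LINT y|lborel. LINT x|lborel. gagliardo q v (bump x0 \<rho>) x y) \<le> - (c2 / 2) * (LINT x|lborel. bump x0 \<rho> x)"
  proof eventually_elim
    case (elim \<rho>)
    have "(LINT y|lborel. LINT x|lborel. gagliardo q v (bump x0 \<rho>) x y)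
      \<le> (c1 * \<rho> powr (2 - 2 * s) - c2) * (LINT x|lborel. bump x0 \<rho> x)"
      by (rule main) (use elim in auto)
    also have "\<dots> \<le> - (c2 / 2) * (LINT x|lborel. bump x0 \<rho> x)"
      using elim by (intro mult_right_mono Bochner_Integration.integral_nonneg) (auto intro: bump_bounds)
    finally show ?case .
  qed
  then show ?thesis using c2 unfolding q_def by (intro exI[of _ "c2 / 2"]) auto
qed

section \<open>The strong maximum principle\<close>

lemma continuous_AE_nonneg_imp_nonneg:
  fixes u :: "'a::euclidean_space \<Rightarrow> real"
  assumes "open \<Omega>" "continuous_on \<Omega> u" "AE x in lebesgue. x \<in> \<Omega> \<longrightarrow> 0 \<le> u x" "x \<in> \<Omega>"
  shows "0 \<le> u x"
proof -
  have "open (\<Omega> \<inter> u -` {..<0})"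
    by (rule continuous_open_preimage[OF assms(2,1)]) simp
  then have "x \<in> - (\<Omega> \<inter> u -` {..<0})"
    by (intro mem_closed_if_AE_lebesgue closed_Compl) (use assms(3) in \<open>auto elim!: eventually_mono\<close>)
  then show ?thesis using assms(4) by auto
qed

theorem proposition1p6:
  fixes \<Omega> :: "(real^'n) set" and u :: "real^'n \<Rightarrow> real" and s \<mu> p lam \<alpha> :: real
  assumes "CARD('n) \<ge> 3"
    and "0 < s" "s < 1"
    and "0 < \<mu>" "\<mu> < real CARD('n)"
    and "1 \<le> p" "p < crit_sobolev TYPE('n) - 1"
    and "0 < \<alpha>" "\<alpha> < 1"
    and "open \<Omega>" "connected \<Omega>" "\<Omega> \<noteq> {}" "bounded \<Omega>"
    and "boundary_Ck_holder 2 \<alpha> \<Omega>"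
    and "Ck_holder_closure 1 \<alpha> \<Omega> u"
    and "Ck_on 2 \<Omega> u"
    and "weak_solution \<Omega> s \<mu> p lam u"
    and "\<not> (AE x in lebesgue. u x = 0)"
  shows "\<forall>x\<in>\<Omega>. u x > 0"
proof (rule ccontr)
  have n: "2 \<le> CARD('n)" using assms(1) by simp
  note s = assms(2,3) and p = assms(6) and \<Omega> = assms(10) and bd = assms(13)
    and C2 = assms(16)
  let ?q = "real CARD('n) + 2 * s"
  have ucl: "continuous_on (closure \<Omega>) u" using assms(15) by simp
  then have uc: "continuous_on \<Omega> u" using closure_subset continuous_on_subset by blast
  have sol: "u \<in> Pi_space \<Omega>" "AE x in lebesgue. x \<in> \<Omega> \<longrightarrow> 0 \<le> u x"
    using assms(17) by (auto simp: weak_solution_def)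
  have u0: "0 \<le> u x" if "x \<in> \<Omega>" for x
    by (rule continuous_AE_nonneg_imp_nonneg[OF \<Omega> uc sol(2) that])
  have uH: "u \<in> H1 \<Omega>" and um: "u \<in> borel_measurable lebesgue" and
    out: "AE x in lebesgue. x \<notin> \<Omega> \<longrightarrow> u x = 0"
    using sol(1) by (auto simp: Pi_space_def H1_0_def H1_def square_integrable_on_def set_borel_measurable_def)
  assume "\<not> (\<forall>x\<in>\<Omega>. u x > 0)"
  then obtain x0 where x0: "x0 \<in> \<Omega>" "u x0 = 0" using u0 by force
  obtain y0 where y0: "y0 \<in> \<Omega>" "0 < u y0"
  proof -
    have "\<exists>y\<in>\<Omega>. u y \<noteq> 0"
    proof (rule ccontr)
      assume "\<not> (\<exists>y\<in>\<Omega>. u y \<noteq> 0)"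
      then have "AE x in lebesgue. u x = 0" using out by (auto elim!: eventually_mono)
      with assms(18) show False ..
    qed
    then show ?thesis using that u0 by (metis less_le)
  qed
  then have xy: "y0 \<noteq> x0" using x0 by auto
  \<comment> \<open>Outside \<open>\<Omega>\<close> the function \<open>u\<close> vanishes almost everywhere only; \<open>v\<close> is a bounded Borel representative.\<close>
  define v where "v x = (if x \<in> \<Omega> then u x else 0)" for x
  have vm: "v \<in> borel_measurable borel"
  proof -
    have "(\<lambda>x. indicator \<Omega> x *\<^sub>R u x) \<in> borel_measurable borel"
      using \<Omega> uc by (intro borel_measurable_continuous_on_indicator) auto
    also have "(\<lambda>x. indicator \<Omega> x *\<^sub>R u x) = v" by (auto simp: v_def fun_eq_iff)
    finally show ?thesis .
  qed
  have uv: "AE x in lebesgue. u x = v x"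
    using out by eventually_elim (auto simp: v_def)
  have v0: "0 \<le> v x" for x using u0 by (simp add: v_def)
  obtain M where M: "\<And>x. v x \<le> M"
  proof -
    have "bounded (u ` closure \<Omega>)"
      by (intro compact_imp_bounded compact_continuous_image[OF ucl]) (use bd in simp)
    then obtain B where "\<forall>x\<in>closure \<Omega>. norm (u x) \<le> B" by (auto simp: bounded_iff)
    then have "u x \<le> B" if "x \<in> \<Omega>" for x
      using closure_subset[of \<Omega>] that by (metis abs_le_D1 real_norm_def subsetD)
    then have "v x \<le> max B 0" for x
      by (auto simp: v_def le_max_iff_disj)
    then show ?thesis by (rule that)
  qed
  have crit: "partial i u x0 = 0" "0 \<le> partial i (partial i u) x0" for i
    using partials_at_interior_minimum[OF \<Omega> C2 x0(1)] u0 x0(2) by auto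
  obtain C r where Cr: "0 \<le> C" "0 < r" "ball x0 r \<subseteq> \<Omega>"
    "\<And>\<rho> x y. \<rho> \<le> r \<Longrightarrow> x \<in> ball x0 \<rho> \<Longrightarrow> y \<in> ball x0 \<rho> \<Longrightarrow> \<bar>u x - u y\<bar> \<le> C * \<rho> * dist x y"
    using C2_lipschitz_at_critical_point[OF \<Omega> C2 x0(1) crit(1)] by blast
  have vL: "\<bar>v x - v y\<bar> \<le> C * \<rho> * dist x y" if "\<rho> \<le> r" "x \<in> ball x0 \<rho>" "y \<in> ball x0 \<rho>" for \<rho> x y
  proof -
    have "x \<in> \<Omega>" "y \<in> \<Omega>" using that Cr(3) by auto
    then show ?thesis using Cr(4)[OF that] by (simp add: v_def)
  qed
  have "open (\<Omega> \<inter> u -` {u y0 / 2<..})"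
    by (rule continuous_open_preimage[OF uc \<Omega>]) simp
  moreover have "y0 \<in> \<Omega> \<inter> u -` {u y0 / 2<..}" using y0 by simp
  ultimately obtain r1' where r1': "0 < r1'" "cball y0 r1' \<subseteq> \<Omega> \<inter> u -` {u y0 / 2<..}"
    using open_contains_cball by blast
  define r1 where "r1 = min r1' (dist x0 y0 / 2)"
  have r1: "0 < r1" "2 * r1 \<le> dist x0 y0" using r1' xy by (auto simp: r1_def)
  have vm0: "u y0 / 2 \<le> v y" if "y \<in> cball y0 r1" for y
  proof -
    have "y \<in> cball y0 r1'" using that by (simp add: r1_def)
    then have "y \<in> \<Omega> \<inter> u -` {u y0 / 2<..}" using r1'(2) by blast
    then show ?thesis by (simp add: v_def)
  qed
  have vx0: "v x0 = 0" using x0 by (simp add: v_def)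
  have half: "0 < u y0 / 2" using y0 by simp
  obtain c where c: "0 < c" and nonlocal: "\<forall>\<^sub>F \<rho> in at_right 0.
    (LINT y|lborel. LINT x|lborel. gagliardo ?q v (bump x0 \<rho>) x y) \<le> - c * (LINT x|lborel. bump x0 \<rho> x)"
    using nonlocal_form_negative_at_zero[OF n s vm v0 M vx0 Cr(1,2) vL r1(1) half vm0 xy r1(2)] by blast
  define A where "A = fractional_const TYPE('n) s"
  have A: "0 < A" unfolding A_def by (rule fractional_const_pos[OF n s])
  \<comment> \<open>The nonlocal term gains \<open>A c I / 2\<close>; with this \<open>\<delta>\<close>, the local and the power term cost half of it.\<close>
  define \<delta> where "\<delta> = A * c / (4 * (1 + \<bar>lam\<bar>))"
  have "k * (A * c / (4 * k)) = A * c / 4" if "0 < k" for k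
    using that by simp
  from this[of "1 + \<bar>lam\<bar>"] have \<delta>: "0 < \<delta>" "(1 + \<bar>lam\<bar>) * \<delta> = A * c / 4"
    unfolding \<delta>_def using A c by simp_all
  define L where "L x = (\<Sum>i\<in>UNIV. partial i (partial i u) x)" for x
  have Lc: "continuous_on \<Omega> L"
    unfolding L_def by (intro continuous_on_sum) (use C2 in \<open>auto simp: numeral_2_eq_2\<close>)
  have upc: "continuous_on \<Omega> (\<lambda>x. u x powr p)"
    by (intro continuous_on_powr' uc continuous_on_const) (use u0 p in auto)
  let ?S = "(\<Omega> \<inter> L -` {- \<delta><..}) \<inter> (\<Omega> \<inter> (\<lambda>x. u x powr p) -` {..<\<delta>})"
  have "open ?S"
    by (intro open_Int continuous_open_preimage[OF Lc \<Omega>] continuous_open_preimage[OF upc \<Omega>]) auto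
  moreover have "x0 \<in> ?S"
  proof -
    have "0 \<le> L x0" unfolding L_def by (intro sum_nonneg crit(2))
    then show ?thesis using x0 \<delta>(1) by simp
  qed
  ultimately obtain r2 where r2: "0 < r2" "cball x0 r2 \<subseteq> ?S"
    using open_contains_cball by blast
  have "\<forall>\<^sub>F \<rho> in at_right 0. 0 < \<rho> \<and> \<rho> < r2"
    by (rule eventually_at_right_real[OF r2(1), THEN eventually_mono]) auto
  with nonlocal have "\<forall>\<^sub>F \<rho> in at_right 0. (0 < \<rho> \<and> \<rho> < r2) \<and>
    (LINT y|lborel. LINT x|lborel. gagliardo ?q v (bump x0 \<rho>) x y) \<le> - c * (LINT x|lborel. bump x0 \<rho> x)"
    by eventually_elim simp
  then obtain \<rho> where \<rho>: "0 < \<rho>" "\<rho> < r2" and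
    nl: "(LINT y|lborel. LINT x|lborel. gagliardo ?q v (bump x0 \<rho>) x y) \<le> - c * (LINT x|lborel. bump x0 \<rho> x)"
    using eventually_happens[of _ "at_right (0::real)"] by (auto simp: trivial_limit_at_right_real)
  define \<phi> where "\<phi> = bump x0 \<rho>"
  have \<phi>0: "0 \<le> \<phi> x" for x by (simp add: \<phi>_def bump_bounds)
  have in_S: "x \<in> ?S" if "\<phi> x \<noteq> 0" for x
  proof -
    have "x \<in> ball x0 \<rho>" using that bump_support[OF \<rho>(1), of x x0] unfolding \<phi>_def by blast
    then have "x \<in> cball x0 r2" using \<rho>(2) by simp
    then show ?thesis using r2(2) by (rule rev_subsetD)
  qed
  have "cball x0 \<rho> \<subseteq> cball x0 r2" using \<rho>(2) by (intro subset_cball) simp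
  then have "cball x0 \<rho> \<subseteq> \<Omega>" using r2(2) by blast
  then have t: "test_function \<Omega> \<phi>" unfolding \<phi>_def by (rule test_function_bump[OF \<rho>(1)])
  obtain K where K: "compact K" "K \<subseteq> \<Omega>" "\<And>x. x \<notin> K \<Longrightarrow> \<phi> x = 0"
    using test_functionD[OF t] by metis
  note \<phi>c = test_function_continuous[OF t]
  define I where "I = (LINT x|lborel. \<phi> x)"
  have I: "0 < I"
  proof -
    obtain c0 where "c0 > 0" "c0 * \<rho> ^ CARD('n) \<le> I"
      using bump_integral_lower_bound[where 'n = 'n] \<rho>(1) unfolding I_def \<phi>_def by blast
    then show ?thesis using \<rho>(1) by (smt (verit) mult_pos_pos zero_less_power)
  qed
  have I\<Omega>: "(LINT x:\<Omega>|lebesgue. \<phi> x) = I" and \<phi>i: "set_integrable lebesgue \<Omega> \<phi>"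
  proof -
    have "(\<lambda>x. if x \<in> \<Omega> then \<phi> x else 0) = \<phi>" using K by (auto simp: fun_eq_iff)
    then show "(LINT x:\<Omega>|lebesgue. \<phi> x) = I"
      using cutoff_set_integral(2)[OF \<Omega> \<phi>c K] by (simp add: I_def)
    show "set_integrable lebesgue \<Omega> \<phi>" by (rule cutoff_set_integral(1)[OF \<Omega> \<phi>c K])
  qed
  have eq: "(LINT x:\<Omega>|lebesgue. weak_gradient \<Omega> u x \<bullet> weak_gradient \<Omega> \<phi> x) +
       A / 2 * (LINT y|lebesgue. LINT x|lebesgue. gagliardo ?q u \<phi> x y)
       = (LINT x:\<Omega>|lebesgue. LINT y:\<Omega>|lebesgue.
            \<bar>u y\<bar> powr crit_choquard TYPE('n) \<mu> *
            \<bar>u x\<bar> powr (crit_choquard TYPE('n) \<mu> - 2) * u x * \<phi> x / norm (x - y) powr \<mu>) +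
         lam * (LINT x:\<Omega>|lebesgue. u x powr p * \<phi> x)"
    using assms(17) test_function_in_Pi_space[OF \<Omega> t]
    unfolding weak_solution_def gagliardo_def A_def by blast
  have local: "(LINT x:\<Omega>|lebesgue. weak_gradient \<Omega> u x \<bullet> weak_gradient \<Omega> \<phi> x) \<le> \<delta> * I"
  proof -
    note P = weak_gradient_pairing_test_function[OF \<Omega> uH C2 t, folded L_def]
    have "(LINT x:\<Omega>|lebesgue. - \<delta> * \<phi> x) \<le> (LINT x:\<Omega>|lebesgue. L x * \<phi> x)"
    proof (rule set_integral_mono[OF _ P(2)])
      show "set_integrable lebesgue \<Omega> (\<lambda>x. - \<delta> * \<phi> x)"
        by (intro set_integrable_mult_right \<phi>i)
      show "- \<delta> * \<phi> x \<le> L x * \<phi> x" for x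
      proof (cases "\<phi> x = 0")
        case False
        then have "- \<delta> \<le> L x" using in_S[of x] by simp
        then show ?thesis using \<phi>0 by (rule mult_right_mono)
      qed simp
    qed
    also have "(LINT x:\<Omega>|lebesgue. - \<delta> * \<phi> x) = - \<delta> * I"
      by (simp only: set_integral_mult_right I\<Omega>)
    finally show ?thesis using P(1) by simp
  qed
  have frac: "(LINT y|lebesgue. LINT x|lebesgue. gagliardo ?q u \<phi> x y) \<le> - c * I"
  proof -
    have "(LINT y|lebesgue. LINT x|lebesgue. gagliardo ?q u \<phi> x y) =
      (LINT y|lborel. LINT x|lborel. gagliardo ?q v \<phi> x y)"
      by (rule iterated_lebesgue_integral_gagliardo_AE[OF um vm borel_measurable_continuous_onI[OF \<phi>c] uv])
    with nl show ?thesis by (simp add: I_def \<phi>_def)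
  qed
  have choquard: "0 \<le> (LINT x:\<Omega>|lebesgue. LINT y:\<Omega>|lebesgue.
            \<bar>u y\<bar> powr crit_choquard TYPE('n) \<mu> *
            \<bar>u x\<bar> powr (crit_choquard TYPE('n) \<mu> - 2) * u x * \<phi> x / norm (x - y) powr \<mu>)"
    unfolding set_lebesgue_integral_def
    using u0 \<phi>0 by (intro Bochner_Integration.integral_nonneg)
      (auto simp: indicator_def intro!: Bochner_Integration.integral_nonneg divide_nonneg_nonneg mult_nonneg_nonneg)
  have power: "- \<bar>lam\<bar> * \<delta> * I \<le> lam * (LINT x:\<Omega>|lebesgue. u x powr p * \<phi> x)"
  proof -
    let ?T = "LINT x:\<Omega>|lebesgue. u x powr p * \<phi> x"
    have "0 \<le> ?T"
      unfolding set_lebesgue_integral_def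
      by (rule Bochner_Integration.integral_nonneg) (auto simp: \<phi>0)
    moreover have "?T \<le> (LINT x:\<Omega>|lebesgue. \<delta> * \<phi> x)"
    proof (rule set_integral_mono)
      show "set_integrable lebesgue \<Omega> (\<lambda>x. u x powr p * \<phi> x)"
        by (rule cutoff_set_integral(1)[OF \<Omega> _ K(1,2)]) (use K(3) upc \<phi>c in \<open>auto intro!: continuous_on_mult\<close>)
      show "set_integrable lebesgue \<Omega> (\<lambda>x. \<delta> * \<phi> x)"
        by (intro set_integrable_mult_right \<phi>i)
      show "u x powr p * \<phi> x \<le> \<delta> * \<phi> x" for x
      proof (cases "\<phi> x = 0")
        case False
        then have "u x powr p \<le> \<delta>" using in_S[of x] by simp
        then show ?thesis using \<phi>0 by (rule mult_right_mono)
      qed simp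
    qed
    ultimately have "\<bar>lam * ?T\<bar> \<le> \<bar>lam\<bar> * (\<delta> * I)"
      unfolding abs_mult by (intro mult_left_mono) (auto simp: I\<Omega>)
    then show ?thesis by (simp add: mult.assoc abs_le_iff)
  qed
  have "A / 2 * (LINT y|lebesgue. LINT x|lebesgue. gagliardo ?q u \<phi> x y) \<le> A / 2 * (- c * I)"
    using A by (intro mult_left_mono frac) simp
  with eq local choquard power have "A / 2 * (c * I) \<le> (1 + \<bar>lam\<bar>) * \<delta> * I"
    by (simp add: algebra_simps)
  then have "A * (I * c) \<le> 0" unfolding \<delta>(2) by simp
  moreover have "0 < A * (I * c)" using A c I by simp
  ultimately show False by simp
qed

end
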